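(* Let $i,j,p$ be integers with $0<i<j$, $\gcd(2j,i,j)=1$ and $p\ge1$, such that either $i=1$ or neither $i$ nor $j$ is a unit in $\mathbb{Z}_{2j}$. The automorphism group of $C_{2j}(i,j_\div p)$ is $$\operatorname{Aut}(C_{2j}(i,j_\div p))=B\rtimes(\mathbb{Z}_{2j}\rtimes H')=(\mathbb{Z}_2)^j\rtimes(\mathbb{Z}_{2j}\rtimes\{\pm1\}),$$ with elements written $\beta\circ(s,t)$, where $\beta\in B$ and $(s,t)\in\mathbb{Z}_{2j}\rtimes\{\pm1\}$.
   Context: $C_{2j}(i,j_\div p)$ is the graph with vertices $u_a$ ($a\in\mathbb{Z}_{2j}$) and $v_a^r$ ($a\in\mathbb{Z}_{2j}$, $1\le r\le p$), with edges $u_au_{a+i}$ for all $a$, and, for each $a\in\mathbb{Z}_{2j}$, the edges of the path $(u_a,v_a^1,\dots,v_a^p,u_{a+j})$ (so $u_a$ and $u_{a+j}$ are joined by two such paths). $U(2j)$ is the group of units of $\mathbb{Z}_{2j}$ and $H'=\{t\in U(2j): t\{\pm i\}=\{\pm i\}\text{ and }t\{\pm j\}=\{\pm j\}\}$, which here equals $\{\pm1\}$. An element $(s,t)\in\mathbb{Z}_{2j}\rtimes\{\pm1\}$ (multiplication $(s,t)(s',t')=(s+ts',tt')$) acts by $(s,t)\cdot u_a=u_{s+ta}$ and $(s,t)\cdot v_a^r=v_{s+ta}^r$. For $a\in\mathbb{Z}_{2j}$, $\beta_a$ is the automorphism fixing every $u_b$, with $\beta_a(v_b^r)=v_{b+j}^{(p+1)-r}$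 if $b\in\{a,a+j\}$ and $\beta_a(v_b^r)=v_b^r$ otherwise; note $\beta_a=\beta_{a+j}$. $B=\langle\beta_a\mid 0\le a<j\rangle\cong(\mathbb{Z}_2)^j$. *)

theory Defs
  imports "HOL-Algebra.Algebra" "HOL-Number_Theory.Residues"
begin

section \<open>External semidirect products\<close>

text \<open>\<open>semidirect N H \<theta>\<close> is \<open>N \<rtimes> H\<close>, where \<open>\<theta>\<close> is a homomorphism from \<open>H\<close> to the automorphism
  group of \<open>N\<close>.\<close>

definition semidirect ::
  "('a, 'c) monoid_scheme \<Rightarrow> ('b, 'd) monoid_scheme \<Rightarrow> ('b \<Rightarrow> 'a \<Rightarrow> 'a) \<Rightarrow> ('a \<times> 'b) monoid"
  where "semidirect N H \<theta> =
    \<lparr>carrier = carrier N \<times> carrier H,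
     monoid.mult = (\<lambda>(n, h) (n', h'). (n \<otimes>\<^bsub>N\<^esub> \<theta> h n', h \<otimes>\<^bsub>H\<^esub> h')),
     one = (\<one>\<^bsub>N\<^esub>, \<one>\<^bsub>H\<^esub>)\<rparr>"

lemma semidirect_group:
  fixes N (structure) and H (structure)
  assumes "group N" "group H" and \<theta>: "\<theta> \<in> hom H (AutoGroup N)"
  shows "group (semidirect N H \<theta>)"
proof -
  interpret N: group N by fact
  interpret H: group H by fact
  interpret A: group "AutoGroup N" by (rule N.AutoGroup)
  interpret T: group_hom H "AutoGroup N" \<theta>
    using \<theta> by unfold_locales
  have auto: "\<theta> h \<in> hom N N" "\<theta> h \<in> Bij (carrier N)" if "h \<in> carrier H" for h
    using T.hom_closed[OF that] by (auto simp: AutoGroup_def auto_def)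
  have cl: "\<theta> h n \<in> carrier N" if "h \<in> carrier H" "n \<in> carrier N" for h n
    using auto(1)[OF that(1)] that(2) by (rule hom_in_carrier)
  have comp: "\<theta> (h \<otimes>\<^bsub>H\<^esub> h') n = \<theta> h (\<theta> h' n)"
    if "h \<in> carrier H" "h' \<in> carrier H" "n \<in> carrier N" for h h' n
    using T.hom_mult[OF that(1,2)] auto[OF that(1)] auto[OF that(2)] that(3)
    by (simp add: AutoGroup_def BijGroup_def compose_def)
  have one: "\<theta> \<one>\<^bsub>H\<^esub> n = n" if "n \<in> carrier N" for n
    using T.hom_one that by (simp add: AutoGroup_def BijGroup_def)
  have mlt: "\<theta> h (n \<otimes>\<^bsub>N\<^esub> n') = \<theta> h n \<otimes>\<^bsub>N\<^esub> \<theta> h n'"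
    if "h \<in> carrier H" "n \<in> carrier N" "n' \<in> carrier N" for h n n'
    using auto(1)[OF that(1)] that(2,3) by (rule hom_mult)
  show ?thesis
  proof (rule groupI)
    fix x assume x: "x \<in> carrier (semidirect N H \<theta>)"
    obtain n h where nh: "x = (n, h)" "n \<in> carrier N" "h \<in> carrier H"
      using x by (auto simp: semidirect_def)
    let ?k = "inv\<^bsub>H\<^esub> h"
    have "(\<theta> ?k (inv\<^bsub>N\<^esub> n), ?k) \<otimes>\<^bsub>semidirect N H \<theta>\<^esub> x = \<one>\<^bsub>semidirect N H \<theta>\<^esub>"
      using nh mlt[of ?k "inv\<^bsub>N\<^esub> n" n] hom_one[OF auto(1), of ?k] N.group_axioms
      by (auto simp: semidirect_def)
    moreover have "(\<theta> ?k (inv\<^bsub>N\<^esub> n), ?k) \<in> carrier (semidirect N H \<theta>)"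
      using nh cl[of ?k "inv\<^bsub>N\<^esub> n"] by (simp add: semidirect_def del: T.hom_inv)
    ultimately show "\<exists>y\<in>carrier (semidirect N H \<theta>).
        y \<otimes>\<^bsub>semidirect N H \<theta>\<^esub> x = \<one>\<^bsub>semidirect N H \<theta>\<^esub>"
      by blast
  qed (auto simp: semidirect_def cl comp one mlt N.m_assoc H.m_assoc
      simp del: T.hom_mult T.hom_one)
qed


section \<open>Automorphism groups of simple graphs\<close>

text \<open>A graph is given by its vertex set \<open>V\<close> and a set \<open>E\<close> of two-element subsets of \<open>V\<close>. As in
  \<^const>\<open>BijGroup\<close>, an automorphism is extensional (\<open>undefined\<close> outside \<open>V\<close>), and
  the product \<open>g \<otimes> f\<close> is the composition of functions \<open>g \<circ> f\<close>.\<close>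

definition graph_automorphisms :: "'v set \<Rightarrow> 'v set set \<Rightarrow> ('v \<Rightarrow> 'v) set"
  where "graph_automorphisms V E =
    {f \<in> Bij V. \<forall>x\<in>V. \<forall>y\<in>V. {f x, f y} \<in> E \<longleftrightarrow> {x, y} \<in> E}"

definition graph_Aut :: "'v set \<Rightarrow> 'v set set \<Rightarrow> ('v \<Rightarrow> 'v) monoid"
  where "graph_Aut V E = (BijGroup V)\<lparr>carrier := graph_automorphisms V E\<rparr>"


section \<open>The graph \<open>C\<^sub>2\<^sub>j(i, j\<^sub>\<div>p)\<close>\<close>

text \<open>The elements of \<open>\<int>\<^sub>2\<^sub>j\<close> are the representatives \<open>0, \<dots>, 2j - 1\<close>, i.e. the carrier of
  \<open>residue_ring (2 * j)\<close>; \<open>Uvert a\<close> is \<open>u\<^sub>a\<close> and \<open>Vvert a r\<close> is \<open>v\<^sub>a\<^sup>r\<close>.\<close>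

datatype vertex = Uvert int | Vvert int int

definition C_verts :: "int \<Rightarrow> int \<Rightarrow> vertex set"
  where "C_verts j p =
    Uvert ` {0..<2 * j} \<union> {Vvert a r | a r. a \<in> {0..<2 * j} \<and> r \<in> {1..p}}"

definition C_edges :: "int \<Rightarrow> int \<Rightarrow> int \<Rightarrow> vertex set set"
  where "C_edges i j p =
    {{Uvert a, Uvert ((a + i) mod (2 * j))} | a. a \<in> {0..<2 * j}} \<union>
    {{Uvert a, Vvert a 1} | a. a \<in> {0..<2 * j}} \<union>
    {{Vvert a r, Vvert a (r + 1)} | a r. a \<in> {0..<2 * j} \<and> 1 \<le> r \<and> r < p} \<union>
    {{Vvert a p, Uvert ((a + j) mod (2 * j))} | a. a \<in> {0..<2 * j}}"

definition C_Aut :: "int \<Rightarrow> int \<Rightarrow> int \<Rightarrow> (vertex \<Rightarrow> vertex) monoid"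
  where "C_Aut i j p = graph_Aut (C_verts j p) (C_edges i j p)"


section \<open>The groups \<open>\<int>\<^sub>2\<^sub>j \<rtimes> T\<close> and their action\<close>

definition H' :: "int \<Rightarrow> int \<Rightarrow> int set"
  where "H' i j = (let R = residue_ring (2 * j) in
    {t \<in> Units R.
       (\<lambda>x. t \<otimes>\<^bsub>R\<^esub> x) ` {i, \<ominus>\<^bsub>R\<^esub> i} = {i, \<ominus>\<^bsub>R\<^esub> i} \<and>
       (\<lambda>x. t \<otimes>\<^bsub>R\<^esub> x) ` {j, \<ominus>\<^bsub>R\<^esub> j} = {j, \<ominus>\<^bsub>R\<^esub> j}})"

definition pm_one :: "int \<Rightarrow> int set"
  where "pm_one j = (let R = residue_ring (2 * j) in {\<one>\<^bsub>R\<^esub>, \<ominus>\<^bsub>R\<^esub> \<one>\<^bsub>R\<^esub>})"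

text \<open>For a subgroup \<open>T\<close> of the group of units of \<open>\<int>\<^sub>2\<^sub>j\<close>, the product
  \<open>\<int>\<^sub>2\<^sub>j \<rtimes> T\<close> has \<open>(s, t) (s', t') = (s + t s', t t')\<close>.\<close>

definition affine_group :: "int \<Rightarrow> int set \<Rightarrow> (int \<times> int) monoid"
  where "affine_group j T = (let R = residue_ring (2 * j) in
    semidirect (add_monoid R) ((units_of R)\<lparr>carrier := T\<rparr>)
      (\<lambda>t. \<lambda>s\<in>carrier R. t \<otimes>\<^bsub>R\<^esub> s))"

definition affine_act :: "int \<Rightarrow> int \<Rightarrow> int \<times> int \<Rightarrow> vertex \<Rightarrow> vertex"
  where "affine_act j p = (\<lambda>(s, t). \<lambda>x\<in>C_verts j p.
    (case x of
       Uvert a \<Rightarrow> Uvert ((s + t * a) mod (2 * j))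
     | Vvert a r \<Rightarrow> Vvert ((s + t * a) mod (2 * j)) r))"


section \<open>The group \<open>B\<close>\<close>

definition beta :: "int \<Rightarrow> int \<Rightarrow> int \<Rightarrow> vertex \<Rightarrow> vertex"
  where "beta j p a = (\<lambda>x\<in>C_verts j p.
    (case x of
       Uvert b \<Rightarrow> Uvert b
     | Vvert b r \<Rightarrow>
         if b \<in> {a, (a + j) mod (2 * j)} then Vvert ((b + j) mod (2 * j)) ((p + 1) - r)
         else Vvert b r))"

definition B_set :: "int \<Rightarrow> int \<Rightarrow> int \<Rightarrow> (vertex \<Rightarrow> vertex) set"
  where "B_set i j p = generate (C_Aut i j p) (beta j p ` {0..<j})"

definition B_group :: "int \<Rightarrow> int \<Rightarrow> int \<Rightarrow> (vertex \<Rightarrow> vertex) monoid"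
  where "B_group i j p = (C_Aut i j p)\<lparr>carrier := B_set i j p\<rparr>"

text \<open>The action of \<open>\<int>\<^sub>2\<^sub>j \<rtimes> H'\<close> on \<open>B\<close> by conjugation inside the automorphism group.\<close>

definition B_conj :: "int \<Rightarrow> int \<Rightarrow> int \<Rightarrow> int \<times> int \<Rightarrow> (vertex \<Rightarrow> vertex) \<Rightarrow> (vertex \<Rightarrow> vertex)"
  where "B_conj i j p d = (\<lambda>b\<in>B_set i j p.
    affine_act j p d \<otimes>\<^bsub>C_Aut i j p\<^esub> b \<otimes>\<^bsub>C_Aut i j p\<^esub> inv\<^bsub>C_Aut i j p\<^esub> (affine_act j p d))"

text \<open>\<open>(\<int>\<^sub>2)\<^sup>j\<close> with its standard generators, the coordinates being indexed by \<open>0, \<dots>, j - 1\<close>.\<close>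

definition Z2_power :: "int \<Rightarrow> (int \<Rightarrow> int) monoid"
  where "Z2_power j = product_group {0..<j} (\<lambda>_. add_monoid (residue_ring 2))"

definition Z2_unit :: "int \<Rightarrow> int \<Rightarrow> int \<Rightarrow> int"
  where "Z2_unit j a = (\<lambda>b\<in>{0..<j}. if b = a then 1 else 0)"

end

theory Submission
  imports Defs
begin

text \<open>The vertices \<open>u\<^sub>a\<close>, called hubs here, have more than two neighbours and the \<open>v\<^sub>a\<^sup>r\<close> have exactly
  two, so automorphisms permute the hubs, and they carry the paths between hubs (strands) to
  such paths. Since strands join \<open>u\<^sub>a\<close> to \<open>u\<^sub>a\<^sub>+\<^sub>j\<close> and the remaining edges join \<open>u\<^sub>a\<close> to \<open>u\<^sub>a\<^sub>+\<^sub>i\<close>, the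
  permutation \<open>g\<close> of \<open>\<int>\<^sub>2\<^sub>j\<close> that an automorphism induces on the hubs satisfies
  \<open>g (a + j) = g a + j\<close> and \<open>g (a + i) = g a \<plusminus> i\<close>.

  In the second relation the sign is constant along \<open>0, i, 2i, \<dots>\<close>, as \<open>g\<close> is injective. Because \<open>i\<close>
  and \<open>j\<close> are coprime, every residue has the form \<open>k i + m j\<close>, and because \<open>-j = j\<close> in \<open>\<int>\<^sub>2\<^sub>j\<close> the
  two relations combine to \<open>g x = g 0 + \<epsilon> x\<close> for one sign \<open>\<epsilon>\<close> (\<open>aut_hub_affine\<close>). The same
  computation shows that \<open>H'\<close> is \<open>{\<plusminus>1}\<close> (\<open>H'_eq\<close>). So on the hubs every automorphism agrees
  with exactly one element of \<open>\<int>\<^sub>2\<^sub>j \<rtimes> {\<plusminus>1}\<close> (\<open>affine_transversal\<close>).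

  An automorphism that fixes all hubs can only exchange, for each antipodal pair
  \<open>{u\<^sub>a, u\<^sub>a\<^sub>+\<^sub>j}\<close>, the two strands between them (\<open>aut_fixing_hubs\<close>). These exchanges are the
  \<open>\<beta>\<^sub>a\<close>, they commute and are independent of each other, so \<open>B\<close> is the kernel of the action on the
  hubs and is isomorphic to \<open>(\<int>\<^sub>2)\<^sup>j\<close> (\<open>B_set_eq_kernel\<close>, \<open>flip_vector_iso\<close>).

  A normal subgroup and a homomorphism whose image contains one representative of each of its
  cosets give a semidirect product (\<open>internal_semidirect\<close>); an isomorphic copy of the normal
  subgroup may be used in its place (\<open>semidirect_transport\<close>).\<close>

section \<open>Automorphism groups of graphs\<close>

lemma group_graph_Aut: "group (graph_Aut V E)"
proof -
  interpret S: group "BijGroup V" by (rule group_BijGroup)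
  have "subgroup (graph_automorphisms V E) (BijGroup V)"
  proof (rule S.subgroupI)
    show "graph_automorphisms V E \<subseteq> carrier (BijGroup V)"
      by (auto simp: graph_automorphisms_def BijGroup_def)
    have "(\<lambda>x\<in>V. x) \<in> graph_automorphisms V E"
      by (simp add: graph_automorphisms_def id_Bij)
    then show "graph_automorphisms V E \<noteq> {}" by blast
  next
    fix f assume f: "f \<in> graph_automorphisms V E"
    then have fB: "f \<in> Bij V" by (simp add: graph_automorphisms_def)
    let ?g = "\<lambda>x\<in>V. inv_into V f x"
    have g: "?g x \<in> V" "f (?g x) = x" if "x \<in> V" for x
      using that fB by (auto simp: Bij_def bij_betw_def inv_into_into f_inv_into_f)
    have "{?g x, ?g y} \<in> E \<longleftrightarrow> {x, y} \<in> E" if "x \<in> V" "y \<in> V" for x y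
    proof -
      have "{f (?g x), f (?g y)} \<in> E \<longleftrightarrow> {?g x, ?g y} \<in> E"
        using f g(1)[OF that(1)] g(1)[OF that(2)] unfolding graph_automorphisms_def by blast
      then show ?thesis using g(2)[OF that(1)] g(2)[OF that(2)] by metis
    qed
    then show "inv\<^bsub>BijGroup V\<^esub> f \<in> graph_automorphisms V E"
      using fB restrict_inv_into_Bij[OF fB] by (simp add: graph_automorphisms_def inv_BijGroup)
  next
    fix f g assume f: "f \<in> graph_automorphisms V E" and g: "g \<in> graph_automorphisms V E"
    then have B: "f \<in> Bij V" "g \<in> Bij V" by (simp_all add: graph_automorphisms_def)
    have "{f (g x), f (g y)} \<in> E \<longleftrightarrow> {x, y} \<in> E" if "x \<in> V" "y \<in> V" for x y
    proof -
      have "g x \<in> V" "g y \<in> V" using Bij_imp_funcset[OF B(2)] that by auto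
      then show ?thesis using f g that unfolding graph_automorphisms_def by blast
    qed
    then show "f \<otimes>\<^bsub>BijGroup V\<^esub> g \<in> graph_automorphisms V E"
      using B by (simp add: graph_automorphisms_def BijGroup_def compose_Bij compose_eq)
  qed
  then show ?thesis
    unfolding graph_Aut_def by (rule S.subgroup_imp_group)
qed

lemma automorphism_if_inverse_pair:
  assumes f: "f \<in> extensional V" "f \<in> V \<rightarrow> V" and g: "g \<in> V \<rightarrow> V"
    and inv: "\<And>x. x \<in> V \<Longrightarrow> g (f x) = x" "\<And>x. x \<in> V \<Longrightarrow> f (g x) = x"
    and E: "\<And>x y. {x, y} \<in> E \<Longrightarrow> {f x, f y} \<in> E" "\<And>x y. {x, y} \<in> E \<Longrightarrow> {g x, g y} \<in> E"
  shows "f \<in> graph_automorphisms V E"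
proof -
  have "bij_betw f V V"
    by (rule bij_betw_byWitness[where f' = g]) (use f g inv in auto)
  moreover have "{f x, f y} \<in> E \<longleftrightarrow> {x, y} \<in> E" if "x \<in> V" "y \<in> V" for x y
    using E(1)[of x y] E(2)[of "f x" "f y"] inv(1)[OF that(1)] inv(1)[OF that(2)] by auto
  ultimately show ?thesis
    using f(1) by (simp add: graph_automorphisms_def Bij_def)
qed

section \<open>Recognising semidirect products\<close>

context group
begin

text \<open>Two facts make \<open>(n, h) \<mapsto> n \<phi>(h)\<close> bijective, namely \<open>N \<phi>(H) = G\<close> and injectivity of \<open>\<phi>\<close> modulo
  \<open>N\<close>. Together they say that the image of \<open>\<phi>\<close> meets every coset of \<open>N\<close> exactly once, which is the
  form in which they are assumed. The map is multiplicative because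
  \<open>n \<phi>(h) n' \<phi>(h') = n (\<phi>(h) n' \<phi>(h)\<inverse>) \<phi>(h h')\<close>.\<close>

lemma internal_semidirect:
  fixes H :: "('h, 'm) monoid_scheme"
  assumes N: "N \<lhd> G" and \<phi>: "\<phi> \<in> hom H G"
    and transversal: "\<forall>g\<in>carrier G. \<exists>!h\<in>carrier H. g \<otimes> inv (\<phi> h) \<in> N"
  defines "\<kappa> \<equiv> \<lambda>h. \<lambda>n\<in>N. \<phi> h \<otimes> n \<otimes> inv (\<phi> h)"
  shows "\<phi> \<in> mon H G"
    and "\<kappa> \<in> hom H (AutoGroup (G\<lparr>carrier := N\<rparr>))"
    and "(\<lambda>(n, h). n \<otimes> \<phi> h) \<in> iso (semidirect (G\<lparr>carrier := N\<rparr>) H \<kappa>) G"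
proof -
  interpret N: normal N G by (rule N)
  have cl: "\<phi> h \<in> carrier G" if "h \<in> carrier H" for h
    using \<phi> that by (rule hom_in_carrier)
  have mlt: "\<phi> (h \<otimes>\<^bsub>H\<^esub> h') = \<phi> h \<otimes> \<phi> h'" if "h \<in> carrier H" "h' \<in> carrier H" for h h'
    using \<phi> that by (rule hom_mult)
  have unique: "h = h'"
    if "h \<in> carrier H" "h' \<in> carrier H" "g \<in> carrier G"
      "g \<otimes> inv (\<phi> h) \<in> N" "g \<otimes> inv (\<phi> h') \<in> N" for g h h'
    using bspec[OF transversal that(3)] that by blast
  have inj: "inj_on \<phi> (carrier H)"
  proof (rule inj_onI)
    fix h h' assume h: "h \<in> carrier H" "h' \<in> carrier H" "\<phi> h = \<phi> h'"
    have "\<phi> h \<otimes> inv (\<phi> h) \<in> N" using cl[OF h(1)] by simp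
    then show "h = h'" using unique[of h h' "\<phi> h"] h cl by metis
  qed
  with \<phi> show "\<phi> \<in> mon H G" by (simp add: mon_def)
  have conj: "\<phi> h \<otimes> n \<otimes> inv (\<phi> h) \<in> N" if "h \<in> carrier H" "n \<in> N" for h n
    using N.inv_op_closed2[OF cl[OF that(1)] that(2)] .
  have conj': "inv (\<phi> h) \<otimes> n \<otimes> \<phi> h \<in> N" if "h \<in> carrier H" "n \<in> N" for h n
    using N.inv_op_closed1[OF cl[OF that(1)] that(2)] .
  have Nc: "n \<in> carrier G" if "n \<in> N" for n
    using that by (rule N.mem_carrier)
  have cancel: "a \<otimes> (inv a \<otimes> b) = b" "inv a \<otimes> (a \<otimes> b) = b"
    if "a \<in> carrier G" "b \<in> carrier G" for a b
    using that by (simp_all add: m_assoc[symmetric])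
  have \<kappa>_Bij: "\<kappa> h \<in> Bij N" if h: "h \<in> carrier H" for h
  proof -
    have "bij_betw (\<kappa> h) N N"
      by (rule bij_betw_byWitness[where f' = "\<lambda>n. inv (\<phi> h) \<otimes> n \<otimes> \<phi> h"])
        (use h cl Nc conj conj' in \<open>auto simp: \<kappa>_def m_assoc cancel\<close>)
    then show ?thesis by (simp add: Bij_def \<kappa>_def)
  qed
  have \<kappa>_hom: "\<kappa> h \<in> hom (G\<lparr>carrier := N\<rparr>) (G\<lparr>carrier := N\<rparr>)" if h: "h \<in> carrier H" for h
    by (rule homI) (use h cl Nc conj in \<open>auto simp: \<kappa>_def m_assoc cancel\<close>)
  show "\<kappa> \<in> hom H (AutoGroup (G\<lparr>carrier := N\<rparr>))"
  proof (rule homI)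
    show "\<kappa> h \<in> carrier (AutoGroup (G\<lparr>carrier := N\<rparr>))" if "h \<in> carrier H" for h
      using \<kappa>_Bij[OF that] \<kappa>_hom[OF that] by (simp add: AutoGroup_def auto_def)
    fix h h' assume h: "h \<in> carrier H" "h' \<in> carrier H"
    have "\<kappa> (h \<otimes>\<^bsub>H\<^esub> h') = compose N (\<kappa> h) (\<kappa> h')"
      by (rule ext)
        (use h cl Nc conj in \<open>auto simp: \<kappa>_def compose_def mlt m_assoc inv_mult_group\<close>)
    then show "\<kappa> (h \<otimes>\<^bsub>H\<^esub> h') = \<kappa> h \<otimes>\<^bsub>AutoGroup (G\<lparr>carrier := N\<rparr>)\<^esub> \<kappa> h'"
      using \<kappa>_Bij h by (simp add: AutoGroup_def BijGroup_def)
  qed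
  show "(\<lambda>(n, h). n \<otimes> \<phi> h) \<in> iso (semidirect (G\<lparr>carrier := N\<rparr>) H \<kappa>) G"
  proof (rule isoI)
    show "(\<lambda>(n, h). n \<otimes> \<phi> h) \<in> hom (semidirect (G\<lparr>carrier := N\<rparr>) H \<kappa>) G"
      by (rule homI) (auto simp: semidirect_def \<kappa>_def cl Nc mlt m_assoc cancel)
    show "bij_betw (\<lambda>(n, h). n \<otimes> \<phi> h) (carrier (semidirect (G\<lparr>carrier := N\<rparr>) H \<kappa>)) (carrier G)"
    proof (intro bij_betw_imageI inj_onI equalityI subsetI)
      fix x y assume xy: "x \<in> carrier (semidirect (G\<lparr>carrier := N\<rparr>) H \<kappa>)"
        "y \<in> carrier (semidirect (G\<lparr>carrier := N\<rparr>) H \<kappa>)"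
        "(\<lambda>(n, h). n \<otimes> \<phi> h) x = (\<lambda>(n, h). n \<otimes> \<phi> h) y"
      then obtain n h n' h' where e: "x = (n, h)" "y = (n', h')" "n \<in> N" "n' \<in> N"
        "h \<in> carrier H" "h' \<in> carrier H" "n \<otimes> \<phi> h = n' \<otimes> \<phi> h'"
        by (auto simp: semidirect_def)
      have "n \<otimes> \<phi> h \<otimes> inv (\<phi> h) = n" "n' \<otimes> \<phi> h' \<otimes> inv (\<phi> h') = n'"
        using e(3-6) cl Nc by (simp_all add: m_assoc)
      then have "h = h'"
        using unique[of h h' "n \<otimes> \<phi> h"] e cl Nc by simp
      then show "x = y" using e cl Nc by simp
    next
      fix g assume "g \<in> (\<lambda>(n, h). n \<otimes> \<phi> h) ` carrier (semidirect (G\<lparr>carrier := N\<rparr>) H \<kappa>)"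
      then show "g \<in> carrier G" by (auto simp: semidirect_def cl Nc)
    next
      fix g assume g: "g \<in> carrier G"
      then obtain h where h: "h \<in> carrier H" "g \<otimes> inv (\<phi> h) \<in> N"
        using transversal by blast
      then have "g = (\<lambda>(n, h). n \<otimes> \<phi> h) (g \<otimes> inv (\<phi> h), h)"
        using g cl by (simp add: m_assoc)
      moreover have "(g \<otimes> inv (\<phi> h), h) \<in> carrier (semidirect (G\<lparr>carrier := N\<rparr>) H \<kappa>)"
        using h by (simp add: semidirect_def)
      ultimately show "g \<in> (\<lambda>(n, h). n \<otimes> \<phi> h) ` carrier (semidirect (G\<lparr>carrier := N\<rparr>) H \<kappa>)"
        by (rule image_eqI[where x = "(g \<otimes> inv (\<phi> h), h)"])
    qed
  qed
qed

end

text \<open>An isomorphism \<open>\<psi>\<close> from \<open>K\<close> to \<open>N\<close> carries an action on \<open>N\<close> back to \<open>K\<close>, namely as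
  \<open>\<psi>\<inverse> \<circ> \<kappa> h \<circ> \<psi>\<close>, and the two semidirect products are then isomorphic.\<close>

lemma semidirect_transport:
  assumes K: "group K" and \<psi>: "\<psi> \<in> iso K N" and \<kappa>: "\<kappa> \<in> hom H (AutoGroup N)"
    and \<mu>: "(\<lambda>(n, h). \<mu> n h) \<in> iso (semidirect N H \<kappa>) G"
  obtains \<theta> where "\<theta> \<in> hom H (AutoGroup K)"
    and "(\<lambda>(x, h). \<mu> (\<psi> x) h) \<in> iso (semidirect K H \<theta>) G"
proof -
  interpret K: group K by (rule K)
  define \<chi> where "\<chi> = inv_into (carrier K) \<psi>"
  have \<chi>: "\<chi> \<in> iso N K" unfolding \<chi>_def using \<psi> by (rule K.iso_set_sym)
  have \<psi>_cl: "\<psi> x \<in> carrier N" if "x \<in> carrier K" for x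
    using \<psi> that by (auto simp: iso_def hom_def)
  have \<chi>_cl: "\<chi> n \<in> carrier K" if "n \<in> carrier N" for n
    using \<chi> that by (auto simp: iso_def hom_def)
  have \<chi>\<psi>: "\<chi> (\<psi> x) = x" if "x \<in> carrier K" for x
    using \<psi> that by (auto simp: \<chi>_def iso_def bij_betw_def)
  have \<psi>\<chi>: "\<psi> (\<chi> n) = n" if "n \<in> carrier N" for n
    using \<psi> that by (auto simp: \<chi>_def iso_def bij_betw_def f_inv_into_f)
  have \<psi>_mult: "\<psi> (x \<otimes>\<^bsub>K\<^esub> y) = \<psi> x \<otimes>\<^bsub>N\<^esub> \<psi> y" if "x \<in> carrier K" "y \<in> carrier K" for x y
    using \<psi> that by (auto simp: iso_def hom_def)
  have \<chi>_mult: "\<chi> (x \<otimes>\<^bsub>N\<^esub> y) = \<chi> x \<otimes>\<^bsub>K\<^esub> \<chi> y" if "x \<in> carrier N" "y \<in> carrier N" for x y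
    using \<chi> that by (auto simp: iso_def hom_def)
  have \<kappa>_hom: "\<kappa> h \<in> hom N N" and \<kappa>_Bij: "\<kappa> h \<in> Bij (carrier N)" if "h \<in> carrier H" for h
    using hom_in_carrier[OF \<kappa> that] by (auto simp: AutoGroup_def auto_def)
  have \<kappa>_cl: "\<kappa> h n \<in> carrier N" if "h \<in> carrier H" "n \<in> carrier N" for h n
    using \<kappa>_hom[OF that(1)] that(2) by (rule hom_in_carrier)
  have \<kappa>_comp: "\<kappa> (h \<otimes>\<^bsub>H\<^esub> h') n = \<kappa> h (\<kappa> h' n)"
    if "h \<in> carrier H" "h' \<in> carrier H" "n \<in> carrier N" for h h' n
    using hom_mult[OF \<kappa> that(1,2)] \<kappa>_Bij[OF that(1)] \<kappa>_Bij[OF that(2)] that(3)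
    by (simp add: AutoGroup_def BijGroup_def compose_eq)
  define \<theta> where "\<theta> = (\<lambda>h. \<lambda>x\<in>carrier K. \<chi> (\<kappa> h (\<psi> x)))"
  have \<theta>_hom: "\<theta> h \<in> hom K K" if h: "h \<in> carrier H" for h
    by (rule homI)
      (use h in \<open>auto simp: \<theta>_def \<chi>_cl \<kappa>_cl \<psi>_cl \<psi>_mult hom_mult[OF \<kappa>_hom[OF h]] \<chi>_mult\<close>)
  have \<theta>_Bij: "\<theta> h \<in> Bij (carrier K)" if h: "h \<in> carrier H" for h
  proof -
    have "bij_betw (\<kappa> h) (carrier N) (carrier N)"
      using \<kappa>_Bij[OF h] by (simp add: Bij_def)
    moreover have "bij_betw \<psi> (carrier K) (carrier N)" "bij_betw \<chi> (carrier N) (carrier K)"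
      using \<psi> \<chi> by (simp_all add: iso_def)
    ultimately have "bij_betw (\<chi> \<circ> (\<kappa> h \<circ> \<psi>)) (carrier K) (carrier K)"
      by (blast intro: bij_betw_trans)
    then have "bij_betw (\<theta> h) (carrier K) (carrier K)"
      by (rule iffD1[OF bij_betw_cong, rotated]) (simp add: \<theta>_def)
    then show ?thesis by (simp add: Bij_def \<theta>_def)
  qed
  have 1: "\<theta> \<in> hom H (AutoGroup K)"
  proof (rule homI)
    show "\<theta> h \<in> carrier (AutoGroup K)" if "h \<in> carrier H" for h
      using \<theta>_Bij[OF that] \<theta>_hom[OF that] by (simp add: AutoGroup_def auto_def)
    fix h h' assume h: "h \<in> carrier H" "h' \<in> carrier H"
    have "\<theta> (h \<otimes>\<^bsub>H\<^esub> h') = compose (carrier K) (\<theta> h) (\<theta> h')"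
      by (rule ext)
        (use h in \<open>auto simp: \<theta>_def compose_def \<kappa>_comp \<chi>_cl \<kappa>_cl \<psi>_cl \<psi>\<chi>\<close>)
    then show "\<theta> (h \<otimes>\<^bsub>H\<^esub> h') = \<theta> h \<otimes>\<^bsub>AutoGroup K\<^esub> \<theta> h'"
      using \<theta>_Bij h by (simp add: AutoGroup_def BijGroup_def)
  qed
  have "map_prod \<psi> id \<in> iso (semidirect K H \<theta>) (semidirect N H \<kappa>)"
  proof (rule isoI)
    show "map_prod \<psi> id \<in> hom (semidirect K H \<theta>) (semidirect N H \<kappa>)"
      by (rule homI) (auto simp: semidirect_def \<theta>_def \<psi>_cl \<psi>_mult \<chi>_cl \<kappa>_cl \<psi>\<chi>)
    show "bij_betw (map_prod \<psi> id) (carrier (semidirect K H \<theta>)) (carrier (semidirect N H \<kappa>))"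
      using \<psi> by (simp add: semidirect_def iso_def bij_betw_map_prod)
  qed
  from iso_set_trans[OF this \<mu>]
  have 2: "(\<lambda>(x, h). \<mu> (\<psi> x) h) \<in> iso (semidirect K H \<theta>) G"
    by (simp add: compose_def o_def case_prod_unfold map_prod_def)
  show thesis using 1 2 by (rule that)
qed


section \<open>Strands\<close>

locale C_graph =
  fixes i j p :: int
  assumes i_pos: "0 < i" and i_less: "i < j" and coprime_ij: "coprime i j" and p_pos: "1 \<le> p"
begin

text \<open>The path \<open>(u\<^sub>a, v\<^sub>a\<^sup>1, \<dots>, v\<^sub>a\<^sup>p, u\<^sub>a\<^sub>+\<^sub>j)\<close> as a function of the position \<open>r\<close> with \<open>0 \<le> r \<le> p + 1\<close>. The
  index \<open>a\<close> is an arbitrary integer, so that sums of indices need no reduction, and both ends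
  are included, so that an argument along a path need not single out its first and last edge.\<close>

definition strand :: "int \<Rightarrow> int \<Rightarrow> vertex" where
  "strand a r = (if r = 0 then Uvert (a mod (2 * j))
     else if r = p + 1 then Uvert ((a + j) mod (2 * j))
     else Vvert (a mod (2 * j)) r)"

abbreviation hub :: "int \<Rightarrow> vertex" where
  "hub a \<equiv> strand a 0"

lemma j_ge_2: "2 \<le> j"
  using i_pos i_less by linarith

lemma shift_neq: "\<not> [a + j = a] (mod 2 * j)" "\<not> [a + i = a - i] (mod 2 * j)"
proof -
  show "\<not> [a + j = a] (mod 2 * j)"
    using j_ge_2 zdvd_imp_le[of "2 * j" j] by (auto simp: cong_iff_dvd_diff)
  show "\<not> [a + i = a - i] (mod 2 * j)"
    using i_pos i_less zdvd_imp_le[of "2 * j" "2 * i"] by (auto simp: cong_iff_dvd_diff)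
qed

lemma strand_cong: "[a = b] (mod 2 * j) \<Longrightarrow> strand a r = strand b r"
  by (auto simp: strand_def cong_def mod_add_cong)

lemma strand_last: "strand a (p + 1) = hub (a + j)"
  using p_pos by (simp add: strand_def)

lemma strand_2j: "strand (a + j + j) r = strand a r" "strand (2 * j + a) r = strand a r"
  by (rule strand_cong, simp add: cong_iff_dvd_diff)+

lemma strand_eq_iff:
  assumes "0 \<le> r" "r \<le> p" "0 \<le> s" "s \<le> p"
  shows "strand a r = strand b s \<longleftrightarrow> r = s \<and> [a = b] (mod 2 * j)"
  using assms by (auto simp: strand_def cong_def)

lemma strand_mem:
  assumes "0 \<le> r" "r \<le> p + 1"
  shows "strand a r \<in> C_verts j p"
  using assms j_ge_2 by (auto simp: strand_def C_verts_def)

text \<open>The far end \<open>r = p + 1\<close> is left out: with \<open>0 \<le> r \<le> p\<close> every vertex is named exactly once up to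
  the choice of \<open>a\<close> modulo \<open>2j\<close>.\<close>

lemma vertex_cases:
  assumes "x \<in> C_verts j p"
  obtains a r where "x = strand a r" "0 \<le> r" "r \<le> p"
proof -
  from assms consider a where "x = Uvert a" "0 \<le> a" "a < 2 * j"
    | a r where "x = Vvert a r" "0 \<le> a" "a < 2 * j" "1 \<le> r" "r \<le> p"
    by (auto simp: C_verts_def)
  then show thesis
  proof cases
    case (1 a)
    then show thesis using p_pos by (intro that[of a 0]) (auto simp: strand_def)
  next
    case (2 a r)
    then show thesis by (intro that[of a r]) (auto simp: strand_def)
  qed
qed

lemma C_edges_strand:
  "C_edges i j p = {{strand a r, strand a (r + 1)} | a r. 0 \<le> r \<and> r \<le> p}
     \<union> {{hub a, hub (a + i)} | a. True}" (is "_ = ?S \<union> ?I")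
proof (intro equalityI subsetI)
  fix e assume "e \<in> C_edges i j p"
  then consider a where "0 \<le> a" "a < 2 * j" "e = {Uvert a, Uvert ((a + i) mod (2 * j))}"
    | a where "0 \<le> a" "a < 2 * j" "e = {Uvert a, Vvert a 1}"
    | a r where "0 \<le> a" "a < 2 * j" "1 \<le> r" "r < p" "e = {Vvert a r, Vvert a (r + 1)}"
    | a where "0 \<le> a" "a < 2 * j" "e = {Vvert a p, Uvert ((a + j) mod (2 * j))}"
    unfolding C_edges_def by (elim UnE CollectE exE conjE) auto
  then show "e \<in> ?S \<union> ?I"
  proof cases
    case (1 a)
    then have "e = {hub a, hub (a + i)}" by (simp add: strand_def)
    then show ?thesis by blast
  next
    case (2 a)
    then have "e = {strand a 0, strand a (0 + 1)}" "(0::int) \<le> 0" "0 \<le> p"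
      using p_pos by (simp_all add: strand_def)
    then show ?thesis by blast
  next
    case (3 a r)
    then have "e = {strand a r, strand a (r + 1)}" "0 \<le> r" "r \<le> p"
      by (simp_all add: strand_def)
    then show ?thesis by blast
  next
    case (4 a)
    then have "e = {strand a p, strand a (p + 1)}" "0 \<le> p" "p \<le> p"
      using p_pos by (simp_all add: strand_def)
    then show ?thesis by blast
  qed
next
  fix e assume "e \<in> ?S \<union> ?I"
  then consider a r where "0 \<le> r" "r \<le> p" "e = {strand a r, strand a (r + 1)}"
    | a where "e = {hub a, hub (a + i)}" by auto
  then show "e \<in> C_edges i j p"
  proof cases
    case (1 a r)
    note edge = this
    let ?a = "a mod (2 * j)"
    have a: "?a \<in> {0..<2 * j}" using j_ge_2 by simp
    consider "r = 0" | "1 \<le> r" "r < p" | "r = p" using 1 by linarith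
    then show ?thesis
    proof cases
      case 1
      then have "e = {Uvert ?a, Vvert ?a 1}" using edge p_pos by (simp add: strand_def)
      then show ?thesis using a unfolding C_edges_def by blast
    next
      case 2
      then have "e = {Vvert ?a r, Vvert ?a (r + 1)}" using edge by (simp add: strand_def)
      then show ?thesis using a 2 unfolding C_edges_def by blast
    next
      case 3
      then have "e = {Vvert ?a p, Uvert ((?a + j) mod (2 * j))}"
        using edge p_pos by (simp add: strand_def mod_simps)
      then show ?thesis using a unfolding C_edges_def by blast
    qed
  next
    case (2 a)
    let ?a = "a mod (2 * j)"
    have a: "?a \<in> {0..<2 * j}" using j_ge_2 by simp
    have "e = {Uvert ?a, Uvert ((?a + i) mod (2 * j))}"
      using 2 by (simp add: strand_def mod_simps)
    then show ?thesis using a unfolding C_edges_def by blast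
  qed
qed

lemma strand_edge: "0 \<le> r \<Longrightarrow> r \<le> p \<Longrightarrow> {strand a r, strand a (r + 1)} \<in> C_edges i j p"
  unfolding C_edges_strand by blast

lemma hub_edge: "{hub a, hub (a + i)} \<in> C_edges i j p"
  unfolding C_edges_strand by blast

lemma interior_neighbours:
  assumes r: "1 \<le> r" "r \<le> p" and e: "{strand a r, y} \<in> C_edges i j p"
  shows "y = strand a (r - 1) \<or> y = strand a (r + 1)"
proof -
  have hub: "strand a r \<noteq> hub b" for b
    using r p_pos by (simp add: strand_eq_iff)
  from e consider b s where "0 \<le> s" "s \<le> p" "{strand a r, y} = {strand b s, strand b (s + 1)}"
    | b where "{strand a r, y} = {hub b, hub (b + i)}"
    unfolding C_edges_strand by blast
  then show ?thesis
  proof cases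
    case (1 b s)
    note edge = this
    then consider "strand a r = strand b s" "y = strand b (s + 1)"
      | "strand a r = strand b (s + 1)" "y = strand b s"
      by (auto simp: doubleton_eq_iff)
    then show ?thesis
    proof cases
      case 1
      then have "r = s" "[a = b] (mod 2 * j)" using r edge by (auto simp: strand_eq_iff)
      then show ?thesis using 1 strand_cong by metis
    next
      case 2
      then have "s \<noteq> p" using hub strand_last by metis
      then have "r = s + 1" "[a = b] (mod 2 * j)"
        using r edge 2 by (auto simp: strand_eq_iff)
      then show ?thesis using 2 strand_cong by (metis add_diff_cancel_right')
    qed
  next
    case (2 b)
    then show ?thesis using hub by (auto simp: doubleton_eq_iff)
  qed
qed

lemma hub_neighbours:
  assumes e: "{hub a, y} \<in> C_edges i j p"
  shows "y \<in> {hub (a + i), hub (a - i), strand a 1, strand (a + j) p}"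
proof -
  from e consider b s where "0 \<le> s" "s \<le> p" "{hub a, y} = {strand b s, strand b (s + 1)}"
    | b where "{hub a, y} = {hub b, hub (b + i)}"
    unfolding C_edges_strand by blast
  then show ?thesis
  proof cases
    case (1 b s)
    note edge = this
    then consider "hub a = strand b s" "y = strand b (s + 1)"
      | "hub a = strand b (s + 1)" "y = strand b s"
      by (auto simp: doubleton_eq_iff)
    then show ?thesis
    proof cases
      case 1
      then have "s = 0" "[a = b] (mod 2 * j)" using edge p_pos by (auto simp: strand_eq_iff)
      then have "y = strand a 1" using 1 strand_cong by (metis add_0)
      then show ?thesis by blast
    next
      case 2
      have "s = p" using edge 2 strand_eq_iff[of 0 "s + 1" a b] p_pos by force
      then have "[a = b + j] (mod 2 * j)"
        using 2 p_pos by (simp add: strand_last strand_eq_iff)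
      then have "[a + j = b + j + j] (mod 2 * j)" by (rule cong_add) simp
      then have "strand (a + j) p = strand b p" using strand_cong strand_2j(1) by metis
      then show ?thesis using 2 \<open>s = p\<close> by simp
    qed
  next
    case (2 b)
    then consider "hub a = hub b" "y = hub (b + i)" | "hub a = hub (b + i)" "y = hub b"
      by (auto simp: doubleton_eq_iff)
    then show ?thesis
    proof cases
      case 1
      then have "[a = b] (mod 2 * j)" using p_pos by (simp add: strand_eq_iff)
      then have "[a + i = b + i] (mod 2 * j)" by (rule cong_add) simp
      then have "hub (a + i) = hub (b + i)" by (rule strand_cong)
      then show ?thesis using 1 by simp
    next
      case 2
      then have "[a = b + i] (mod 2 * j)" using p_pos by (simp add: strand_eq_iff)
      then have "[a - i = b + i - i] (mod 2 * j)" by (rule cong_diff) simp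
      then have "hub (a - i) = hub b" using strand_cong by (metis add_diff_cancel_right')
      then show ?thesis using 2 by simp
    qed
  qed
qed

section \<open>Automorphisms along the strands and on the hubs\<close>

abbreviation Auts :: "(vertex \<Rightarrow> vertex) set" where
  "Auts \<equiv> graph_automorphisms (C_verts j p) (C_edges i j p)"

lemma aut_mem: "f \<in> Auts \<Longrightarrow> x \<in> C_verts j p \<Longrightarrow> f x \<in> C_verts j p"
  using Bij_imp_funcset by (fastforce simp: graph_automorphisms_def)

lemma aut_inj: "f \<in> Auts \<Longrightarrow> x \<in> C_verts j p \<Longrightarrow> y \<in> C_verts j p \<Longrightarrow> f x = f y \<longleftrightarrow> x = y"
  by (auto simp: graph_automorphisms_def Bij_def bij_betw_def inj_on_def)

lemma edge_verts:
  assumes "{x, y} \<in> C_edges i j p"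
  shows "x \<in> C_verts j p" "y \<in> C_verts j p"
proof -
  have "{x, y} \<subseteq> C_verts j p"
    using assms p_pos unfolding C_edges_strand
    by (elim UnE CollectE exE conjE) (simp_all add: strand_mem)
  then show "x \<in> C_verts j p" "y \<in> C_verts j p" by simp_all
qed

lemma aut_edge: "f \<in> Auts \<Longrightarrow> {x, y} \<in> C_edges i j p \<Longrightarrow> {f x, f y} \<in> C_edges i j p"
  using edge_verts by (auto simp: graph_automorphisms_def)

lemma extensional_strand_eqI:
  assumes "f \<in> extensional (C_verts j p)" "g \<in> extensional (C_verts j p)"
    and "\<And>a r. 0 \<le> r \<Longrightarrow> r \<le> p \<Longrightarrow> f (strand a r) = g (strand a r)"
  shows "f = g"
proof (rule extensionalityI[OF assms(1,2)])
  fix x assume "x \<in> C_verts j p"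
  then show "f x = g x" by (rule vertex_cases) (simp add: assms(3))
qed

text \<open>A hub has at least three distinct neighbours and an interior vertex of a
  strand has two, so an automorphism cannot take a hub into the interior of a strand.\<close>

lemma aut_hub:
  assumes f: "f \<in> Auts"
  obtains b where "f (hub a) = hub b"
proof -
  obtain b r where br: "f (hub a) = strand b r" "0 \<le> r" "r \<le> p"
  proof (rule vertex_cases)
    show "f (hub a) \<in> C_verts j p" using p_pos by (intro aut_mem[OF f] strand_mem) simp_all
  qed
  have "r = 0"
  proof (rule ccontr)
    assume "r \<noteq> 0"
    then have r: "1 \<le> r" using br by simp
    let ?N = "{hub (a + i), hub (a - i), strand a 1}"
    have "{hub a, y} \<in> C_edges i j p" if "y \<in> ?N" for y
      using that hub_edge[of a] hub_edge[of "a - i"] strand_edge[of 0 a] p_pos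
      by (auto simp: insert_commute)
    then have "f ` ?N \<subseteq> {strand b (r - 1), strand b (r + 1)}"
      using aut_edge[OF f, of "hub a"] interior_neighbours[OF r br(3)] br(1) by fastforce
    then have "card (f ` ?N) \<le> card {strand b (r - 1), strand b (r + 1)}"
      by (intro card_mono) auto
    moreover have "card {strand b (r - 1), strand b (r + 1)} \<le> 2"
      by (simp add: card_insert_if)
    moreover have "card ?N = 3"
      using p_pos shift_neq(2)[of a] by (simp add: strand_eq_iff)
    moreover have "?N \<subseteq> C_verts j p"
      using p_pos by (simp add: strand_mem)
    then have "inj_on f ?N"
      using aut_inj[OF f] by (meson inj_onI subsetD)
    then have "card (f ` ?N) = card ?N" by (rule card_image)
    ultimately show False by linarith
  qed
  with br that show thesis by blast
qed

text \<open>There are finitely many hubs and automorphisms are injective, so mapping hubs to hubs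
  already means permuting them; hence interior vertices stay interior.\<close>

lemma aut_hub_image: "f \<in> Auts \<Longrightarrow> f ` range hub = range hub"
proof -
  assume f: "f \<in> Auts"
  have "range hub \<subseteq> Uvert ` {0..<2 * j}"
    using j_ge_2 by (auto simp: strand_def)
  then have "finite (range hub)" by (rule finite_subset) simp
  then show ?thesis
  proof (rule endo_inj_surj)
    show "f ` range hub \<subseteq> range hub" using aut_hub[OF f] by blast
    show "inj_on f (range hub)"
      using aut_inj[OF f] strand_mem p_pos by (auto simp: inj_on_def)
  qed
qed

lemma aut_interior:
  assumes f: "f \<in> Auts" and r: "1 \<le> r" "r \<le> p"
  shows "f (strand a r) \<noteq> hub b"
proof
  assume "f (strand a r) = hub b"
  then have "f (strand a r) \<in> f ` range hub" using aut_hub_image[OF f] by blast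
  then obtain c where c: "f (strand a r) = f (hub c)"
    by blast
  then have "strand a r = hub c"
    using aut_inj[OF f strand_mem strand_mem, of r 0] r by force
  then show False using r by (simp add: strand_eq_iff)
qed

text \<open>Once the images of the first two vertices of a strand are known, the rest is forced: an
  interior vertex of a path \<open>Q\<close> has only its two neighbours on \<open>Q\<close>, and injectivity excludes
  going back. The path \<open>Q\<close> is left open because the image strand may be traversed in either
  direction.\<close>

lemma aut_follows_path:
  assumes f: "f \<in> Auts"
    and Q: "\<And>r y. 1 \<le> r \<Longrightarrow> r \<le> p \<Longrightarrow> {Q r, y} \<in> C_edges i j p \<Longrightarrow> y = Q (r - 1) \<or> y = Q (r + 1)"
    and start: "f (strand a 0) = Q 0" "f (strand a 1) = Q 1"
    and r: "0 \<le> r" "r \<le> p + 1"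
  shows "f (strand a r) = Q r"
proof -
  have "f (strand a (int n)) = Q (int n) \<and> f (strand a (int n + 1)) = Q (int n + 1)"
    if "int n \<le> p" for n
    using that
  proof (induction n)
    case 0
    then show ?case using start by simp
  next
    case (Suc n)
    let ?s = "int n + 1"
    have s: "1 \<le> ?s" "?s \<le> p" using Suc.prems by simp_all
    have IH: "f (strand a (?s - 1)) = Q (?s - 1)" "f (strand a ?s) = Q ?s"
      using Suc by simp_all
    have "{Q ?s, f (strand a (?s + 1))} \<in> C_edges i j p"
      using aut_edge[OF f strand_edge[of ?s a]] s IH by simp
    then have alt: "f (strand a (?s + 1)) = Q (?s - 1) \<or> f (strand a (?s + 1)) = Q (?s + 1)"
      using Q s by blast
    have "strand a (?s + 1) \<noteq> strand a (?s - 1)"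
    proof (cases "?s = p")
      case True
      then show ?thesis
        using p_pos shift_neq(1)[of a] by (auto simp: strand_last strand_eq_iff)
    next
      case False
      then show ?thesis using s by (simp add: strand_eq_iff)
    qed
    then have "f (strand a (?s + 1)) \<noteq> f (strand a (?s - 1))"
      using aut_inj[OF f strand_mem strand_mem, of "?s + 1" "?s - 1" a a] s by simp
    then show ?case using alt IH by (simp add: add.commute)
  qed
  note walk = this
  show ?thesis
  proof (cases "r = p + 1")
    case True
    then show ?thesis using walk[of "nat p"] p_pos by simp
  next
    case False
    then show ?thesis using walk[of "nat r"] r by simp
  qed
qed

text \<open>The two strands that start at \<open>u\<^sub>b\<close> are the one of index \<open>b\<close> and the one of index \<open>b + j\<close> read
  backwards. Both end at \<open>u\<^sub>b\<^sub>+\<^sub>j\<close>, which is why automorphisms respect antipodal pairs of hubs.\<close>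

lemma aut_strand:
  assumes f: "f \<in> Auts" and b: "f (hub a) = hub b"
  shows "(\<forall>r\<in>{0..p + 1}. f (strand a r) = strand b r)
    \<or> (\<forall>r\<in>{0..p + 1}. f (strand a r) = strand (b + j) (p + 1 - r))"
proof -
  have "{hub b, f (strand a 1)} \<in> C_edges i j p"
    using aut_edge[OF f strand_edge[of 0 a]] b p_pos by simp
  then have "f (strand a 1) = strand b 1 \<or> f (strand a 1) = strand (b + j) p"
    using hub_neighbours aut_interior[OF f, of 1 a] p_pos by blast
  then show ?thesis
  proof
    assume 1: "f (strand a 1) = strand b 1"
    have "f (strand a r) = strand b r" if "0 \<le> r" "r \<le> p + 1" for r
      using f interior_neighbours b 1 that by (rule aut_follows_path)
    then show ?thesis by simp
  next
    assume 1: "f (strand a 1) = strand (b + j) p"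
    have "f (strand a r) = strand (b + j) (p + 1 - r)" if "0 \<le> r" "r \<le> p + 1" for r
    proof (rule aut_follows_path[OF f _ _ _ that])
      show "f (hub a) = strand (b + j) (p + 1 - 0)"
        using b strand_last[of "b + j"] strand_2j(1)[of b 0] by simp
      show "f (strand a 1) = strand (b + j) (p + 1 - 1)" using 1 by simp
      fix r y assume "1 \<le> r" "r \<le> p" "{strand (b + j) (p + 1 - r), y} \<in> C_edges i j p"
      then show "y = strand (b + j) (p + 1 - (r - 1)) \<or> y = strand (b + j) (p + 1 - (r + 1))"
        using interior_neighbours[of "p + 1 - r" "b + j" y] by (auto simp: algebra_simps)
    qed
    then show ?thesis by simp
  qed
qed

lemma aut_antipode:
  assumes f: "f \<in> Auts" and b: "f (hub a) = hub b"
  shows "f (hub (a + j)) = hub (b + j)"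
  using aut_strand[OF f b] p_pos by (auto simp: strand_last dest: bspec[of _ _ "p + 1"])

lemma aut_hub_step:
  assumes f: "f \<in> Auts" and b: "f (hub a) = hub b"
  shows "f (hub (a + i)) = hub (b + i) \<or> f (hub (a + i)) = hub (b - i)"
proof -
  obtain c where c: "f (hub (a + i)) = hub c" using aut_hub[OF f] .
  have "{hub b, hub c} \<in> C_edges i j p" using aut_edge[OF f hub_edge[of a]] b c by simp
  then have "hub c \<in> {hub (b + i), hub (b - i), strand b 1, strand (b + j) p}"
    by (rule hub_neighbours)
  moreover have "hub c \<noteq> strand b 1" "hub c \<noteq> strand (b + j) p"
    using p_pos by (auto simp: strand_eq_iff)
  ultimately show ?thesis using c by auto
qed

text \<open>Injectivity forbids turning back along the cycle \<open>u\<^sub>0, u\<^sub>i, u\<^sub>2\<^sub>i, \<dots>\<close>, so the sign of the first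
  step is the sign of all steps. This uses that \<open>a + i\<close> and \<open>a - i\<close> differ modulo \<open>2j\<close>.\<close>

lemma aut_hub_walk:
  assumes f: "f \<in> Auts" and b: "f (hub 0) = hub b" and e: "\<epsilon> = 1 \<or> \<epsilon> = -1"
    and start: "f (hub i) = hub (b + \<epsilon> * i)"
  shows "f (hub (int k * i)) = hub (b + \<epsilon> * (int k * i))"
proof -
  have "f (hub (int k * i)) = hub (b + \<epsilon> * (int k * i))
    \<and> f (hub (int (Suc k) * i)) = hub (b + \<epsilon> * (int (Suc k) * i))"
  proof (induction k)
    case 0
    then show ?case using b start by simp
  next
    case (Suc k)
    let ?a = "int (Suc k) * i" and ?b = "b + \<epsilon> * (int (Suc k) * i)"
    have alt: "f (hub (?a + i)) = hub (?b + i) \<or> f (hub (?a + i)) = hub (?b - i)"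
      using f Suc by (intro aut_hub_step) auto
    have "hub (?a + i) \<noteq> hub (?a - i)"
      using shift_neq(2)[of ?a] p_pos by (simp add: strand_eq_iff)
    then have "f (hub (?a + i)) \<noteq> f (hub (?a - i))"
      using aut_inj[OF f strand_mem strand_mem, of 0 0] p_pos by simp
    also have "f (hub (?a - i)) = hub (?b - \<epsilon> * i)"
      using Suc by (simp add: algebra_simps)
    finally have "f (hub (?a + i)) = hub (?b + \<epsilon> * i)"
      using alt e by auto
    then show ?case using Suc by (simp add: algebra_simps)
  qed
  then show ?thesis ..
qed

text \<open>Steps by \<open>i\<close> and one antipodal step reach every hub from \<open>u\<^sub>0\<close>, because \<open>i\<close> and \<open>j\<close> are coprime;
  two antipodal steps cancel modulo \<open>2j\<close>.\<close>

lemma residue_decomp: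
  obtains k :: nat and m :: int
  where "m = 0 \<or> m = 1" "[x = int k * i + m * j] (mod 2 * j)"
proof -
  obtain u v where uv: "u * i + v * j = 1"
    using bezout_int[of i j] coprime_ij by (auto simp: coprime_iff_gcd_eq_1)
  let ?k = "nat ((x * u) mod (2 * j))" and ?m = "(x * v) mod 2"
  have k: "int ?k = (x * u) mod (2 * j)" using j_ge_2 by simp
  have "[x * u = int ?k] (mod 2 * j)" unfolding k by simp
  then have "[x * u * i = int ?k * i] (mod 2 * j)" by (rule cong_mult) simp
  moreover have "[x * v * j = ?m * j] (mod 2 * j)"
    by (simp add: cong_def mod_mult_mult2)
  ultimately have "[x * u * i + x * v * j = int ?k * i + ?m * j] (mod 2 * j)"
    by (rule cong_add)
  also have "x * u * i + x * v * j = x"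
    using arg_cong[OF uv, of "\<lambda>z. x * z"] by (simp add: algebra_simps)
  finally show thesis by (rule that[rotated]) auto
qed

text \<open>The antipodal step \<open>j\<close> is its own negative modulo \<open>2j\<close>. So the sign found on the cycle of
  \<open>u\<^sub>0\<close> also governs the antipodal hubs.\<close>

lemma mult_pm_j: "\<epsilon> = 1 \<or> \<epsilon> = -1 \<Longrightarrow> [m * j = \<epsilon> * (m * j)] (mod 2 * j)" for \<epsilon> m :: int
  by (auto simp: cong_iff_dvd_diff)

text \<open>The sign of the first step from \<open>u\<^sub>0\<close> determines the map on all hubs: write the index as
  \<open>k i + m j\<close>, walk \<open>k\<close> steps along the cycle, and step to the antipode if \<open>m = 1\<close>.\<close>

lemma aut_hub_affine:
  assumes f: "f \<in> Auts"
  shows "\<exists>b \<epsilon>. (\<epsilon> = 1 \<or> \<epsilon> = -1) \<and> (\<forall>x. f (hub x) = hub (b + \<epsilon> * x))"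
proof -
  obtain b where b: "f (hub 0) = hub b" using aut_hub[OF f] .
  then obtain \<epsilon> where e: "\<epsilon> = 1 \<or> \<epsilon> = -1" "f (hub i) = hub (b + \<epsilon> * i)"
    using aut_hub_step[OF f b] by (auto intro: that[of 1] that[of "-1"])
  have "f (hub x) = hub (b + \<epsilon> * x)" for x
  proof -
    obtain k m where m: "m = 0 \<or> m = 1" and x: "[x = int k * i + m * j] (mod 2 * j)"
      by (rule residue_decomp)
    have walk: "f (hub (int k * i)) = hub (b + \<epsilon> * (int k * i))"
      using f b e by (rule aut_hub_walk)
    have "f (hub (int k * i + m * j)) = hub (b + \<epsilon> * (int k * i) + m * j)"
      using m walk aut_antipode[OF f walk] by auto
    moreover have "hub x = hub (int k * i + m * j)" using x by (rule strand_cong)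
    moreover have "hub (b + \<epsilon> * x) = hub (b + \<epsilon> * (int k * i) + m * j)"
    proof (rule strand_cong)
      have "[b + \<epsilon> * x = b + \<epsilon> * (int k * i + m * j)] (mod 2 * j)"
        using x by (intro cong_add cong_mult) auto
      also have "b + \<epsilon> * (int k * i + m * j) = b + \<epsilon> * (int k * i) + \<epsilon> * (m * j)"
        by (simp add: algebra_simps)
      also have "[\<dots> = b + \<epsilon> * (int k * i) + m * j] (mod 2 * j)"
        using cong_sym[OF mult_pm_j[OF e(1), of m]] by (intro cong_add) auto
      finally show "[b + \<epsilon> * x = b + \<epsilon> * (int k * i) + m * j] (mod 2 * j)" .
    qed
    ultimately show ?thesis by simp
  qed
  with e(1) show ?thesis by blast
qed


section \<open>The automorphism group of the graph\<close>

lemma edge_preserving: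
  assumes "\<And>a r. 0 \<le> r \<Longrightarrow> r \<le> p \<Longrightarrow> {f (strand a r), f (strand a (r + 1))} \<in> C_edges i j p"
    and "\<And>a. {f (hub a), f (hub (a + i))} \<in> C_edges i j p"
    and "{x, y} \<in> C_edges i j p"
  shows "{f x, f y} \<in> C_edges i j p"
proof -
  consider a r where "0 \<le> r" "r \<le> p" "{x, y} = {strand a r, strand a (r + 1)}"
    | a where "{x, y} = {hub a, hub (a + i)}"
    using assms(3) unfolding C_edges_strand by blast
  then have "f ` {x, y} \<in> C_edges i j p" by cases (simp_all add: assms(1,2))
  then show ?thesis by simp
qed

lemma C_Aut_carrier: "carrier (C_Aut i j p) = Auts"
  by (simp add: C_Aut_def graph_Aut_def)

sublocale Aut: group "C_Aut i j p"
  unfolding C_Aut_def by (rule group_graph_Aut)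

lemma Aut_mult: "f \<in> Auts \<Longrightarrow> g \<in> Auts \<Longrightarrow> f \<otimes>\<^bsub>C_Aut i j p\<^esub> g = compose (C_verts j p) f g"
  by (simp add: C_Aut_def graph_Aut_def BijGroup_def graph_automorphisms_def)

lemma Aut_mult_apply:
  "f \<in> Auts \<Longrightarrow> g \<in> Auts \<Longrightarrow> x \<in> C_verts j p \<Longrightarrow> (f \<otimes>\<^bsub>C_Aut i j p\<^esub> g) x = f (g x)"
  by (simp add: Aut_mult compose_eq)

lemma Aut_one: "\<one>\<^bsub>C_Aut i j p\<^esub> = (\<lambda>x\<in>C_verts j p. x)"
  by (simp add: C_Aut_def graph_Aut_def BijGroup_def)

lemma Aut_inv_apply:
  assumes "f \<in> Auts" "x \<in> C_verts j p"
  shows "(inv\<^bsub>C_Aut i j p\<^esub> f) (f x) = x"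
proof -
  have "inv\<^bsub>C_Aut i j p\<^esub> f \<in> Auts" using Aut.inv_closed assms(1) by (simp add: C_Aut_carrier)
  then have "(inv\<^bsub>C_Aut i j p\<^esub> f) (f x) = (inv\<^bsub>C_Aut i j p\<^esub> f \<otimes>\<^bsub>C_Aut i j p\<^esub> f) x"
    using assms by (simp add: Aut_mult_apply)
  also have "\<dots> = x" using assms by (simp add: C_Aut_carrier Aut_one)
  finally show ?thesis .
qed

lemma aut_extensional: "f \<in> Auts \<Longrightarrow> f \<in> extensional (C_verts j p)"
  by (simp add: graph_automorphisms_def Bij_def)

lemma hub_mem [simp]: "hub a \<in> C_verts j p"
  using p_pos by (intro strand_mem) simp_all

text \<open>This turns membership in the kernel of the action on the hubs into agreement on the hubs,
  the form in which automorphisms are compared below.\<close>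

lemma same_on_hubs_iff:
  assumes g: "g \<in> Auts" and k: "k \<in> Auts"
  shows "(\<forall>a. (g \<otimes>\<^bsub>C_Aut i j p\<^esub> inv\<^bsub>C_Aut i j p\<^esub> k) (hub a) = hub a)
    \<longleftrightarrow> (\<forall>a. g (hub a) = k (hub a))"
proof -
  have ik: "inv\<^bsub>C_Aut i j p\<^esub> k \<in> Auts"
    using Aut.inv_closed k by (simp add: C_Aut_carrier)
  have comp: "(g \<otimes>\<^bsub>C_Aut i j p\<^esub> inv\<^bsub>C_Aut i j p\<^esub> k) (k (hub c)) = g (hub c)" for c
    using g k ik by (simp add: Aut_mult_apply aut_mem Aut_inv_apply)
  show ?thesis
  proof (intro iffI allI)
    fix a assume fix_all: "\<forall>a. (g \<otimes>\<^bsub>C_Aut i j p\<^esub> inv\<^bsub>C_Aut i j p\<^esub> k) (hub a) = hub a"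
    obtain b where "k (hub a) = hub b" using aut_hub[OF k] .
    then show "g (hub a) = k (hub a)" using comp[of a] fix_all by simp
  next
    fix a assume same: "\<forall>a. g (hub a) = k (hub a)"
    have "hub a \<in> k ` range hub" using aut_hub_image[OF k] by blast
    then obtain c where "hub a = k (hub c)" by blast
    then show "(g \<otimes>\<^bsub>C_Aut i j p\<^esub> inv\<^bsub>C_Aut i j p\<^esub> k) (hub a) = hub a"
      using comp[of c] same by simp
  qed
qed


section \<open>The affine part\<close>

lemma residues_2j: "residues (2 * j)"
  using j_ge_2 by unfold_locales simp

lemma pm_one_eq: "pm_one j = {1 mod (2 * j), (-1) mod (2 * j)}"
  using j_ge_2 residues.res_neg_eq[OF residues_2j] residues.res_one_eq[OF residues_2j]
  by (simp add: pm_one_def Let_def)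

lemma pm_one_cases:
  assumes "t \<in> pm_one j"
  obtains \<epsilon> where "\<epsilon> = 1 \<or> \<epsilon> = -1" "t = \<epsilon> mod (2 * j)"
  using assms unfolding pm_one_eq by blast

lemma affine_carrier: "carrier (affine_group j T) = {0..<2 * j} \<times> T"
  by (auto simp: affine_group_def semidirect_def residue_ring_def Let_def)

lemma affine_mult:
  assumes "0 \<le> s'" "s' < 2 * j"
  shows "(s, \<epsilon> mod (2 * j)) \<otimes>\<^bsub>affine_group j T\<^esub> (s', \<epsilon>' mod (2 * j))
    = ((s + \<epsilon> * s') mod (2 * j), (\<epsilon> * \<epsilon>') mod (2 * j))"
  using assms
  by (simp add: affine_group_def semidirect_def residue_ring_def units_of_def Let_def mod_simps)

text \<open>Writing the unit as \<open>\<epsilon> mod 2j\<close> with an integer sign \<open>\<epsilon>\<close> makes the action plain integer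
  arithmetic on strand indices. The far end \<open>r = p + 1\<close> is covered because \<open>\<epsilon> j \<equiv> j\<close> modulo \<open>2j\<close>.\<close>

lemma affine_strand:
  assumes e: "\<epsilon> = 1 \<or> \<epsilon> = -1" and r: "0 \<le> r" "r \<le> p + 1"
  shows "affine_act j p (s, \<epsilon> mod (2 * j)) (strand a r) = strand (s + \<epsilon> * a) r"
proof -
  have reduce: "(s + \<epsilon> mod (2 * j) * (b mod (2 * j))) mod (2 * j) = (s + \<epsilon> * b) mod (2 * j)" for b
    by (metis mod_add_right_eq mod_mult_eq)
  consider "r = 0" | "1 \<le> r" "r \<le> p" | "r = p + 1" using r by linarith
  then show ?thesis
  proof cases
    case 3
    have "[\<epsilon> * j = j] (mod 2 * j)" using mult_pm_j[OF e, of 1] by (simp add: cong_sym)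
    then have "[s + \<epsilon> * a + \<epsilon> * j = s + \<epsilon> * a + j] (mod 2 * j)" by (intro cong_add) simp_all
    then have "(s + \<epsilon> * (a + j)) mod (2 * j) = (s + \<epsilon> * a + j) mod (2 * j)"
      by (simp add: cong_def algebra_simps)
    moreover have "Uvert ((a + j) mod (2 * j)) \<in> C_verts j p"
      using j_ge_2 by (simp add: C_verts_def)
    ultimately show ?thesis
      using 3 p_pos by (simp add: affine_act_def strand_def reduce)
  qed (use j_ge_2 p_pos in \<open>simp_all add: affine_act_def strand_def C_verts_def reduce\<close>)
qed

lemma affine_extensional: "affine_act j p d \<in> extensional (C_verts j p)"
  by (simp add: affine_act_def split: prod.split)

lemma affine_edge:
  assumes e: "\<epsilon> = 1 \<or> \<epsilon> = -1" and xy: "{x, y} \<in> C_edges i j p"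
  shows "{affine_act j p (s, \<epsilon> mod (2 * j)) x, affine_act j p (s, \<epsilon> mod (2 * j)) y} \<in> C_edges i j p"
proof (rule edge_preserving[OF _ _ xy])
  fix a
  have hub: "affine_act j p (s, \<epsilon> mod (2 * j)) (hub b) = hub (s + \<epsilon> * b)" for b
    using affine_strand[OF e, of 0] p_pos by simp
  show "{affine_act j p (s, \<epsilon> mod (2 * j)) (hub a), affine_act j p (s, \<epsilon> mod (2 * j)) (hub (a + i))}
      \<in> C_edges i j p"
    unfolding hub using e hub_edge[of "s + a"] hub_edge[of "s - a - i"]
    by (auto simp: algebra_simps insert_commute)
qed (simp add: affine_strand[OF e] strand_edge)

lemma affine_inverse:
  assumes e: "\<epsilon> = 1 \<or> \<epsilon> = -1" and x: "x \<in> C_verts j p"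
  shows "affine_act j p (s, \<epsilon> mod (2 * j)) (affine_act j p (- (\<epsilon> * s), \<epsilon> mod (2 * j)) x) = x"
proof -
  obtain a r where "x = strand a r" "0 \<le> r" "r \<le> p" using vertex_cases[OF x] .
  then show ?thesis using e by (auto simp: affine_strand)
qed

lemma affine_mem:
  assumes e: "\<epsilon> = 1 \<or> \<epsilon> = -1" and x: "x \<in> C_verts j p"
  shows "affine_act j p (s, \<epsilon> mod (2 * j)) x \<in> C_verts j p"
proof -
  obtain a r where "x = strand a r" "0 \<le> r" "r \<le> p" using vertex_cases[OF x] .
  then show ?thesis using e by (simp add: affine_strand strand_mem)
qed

lemma affine_aut:
  assumes e: "\<epsilon> = 1 \<or> \<epsilon> = -1"
  shows "affine_act j p (s, \<epsilon> mod (2 * j)) \<in> Auts"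
proof (rule automorphism_if_inverse_pair[where g = "affine_act j p (- (\<epsilon> * s), \<epsilon> mod (2 * j))"])
  have s: "- (\<epsilon> * - (\<epsilon> * s)) = s" using e by auto
  show "affine_act j p (- (\<epsilon> * s), \<epsilon> mod (2 * j)) (affine_act j p (s, \<epsilon> mod (2 * j)) x) = x"
    if "x \<in> C_verts j p" for x
    using affine_inverse[OF e that, of "- (\<epsilon> * s)"] unfolding s .
qed (use e in \<open>auto simp: affine_extensional affine_mem affine_edge affine_inverse\<close>)

lemma affine_hom: "affine_act j p \<in> hom (affine_group j (pm_one j)) (C_Aut i j p)"
proof (rule homI)
  fix d assume "d \<in> carrier (affine_group j (pm_one j))"
  then show "affine_act j p d \<in> carrier (C_Aut i j p)"
    by (auto simp: affine_carrier C_Aut_carrier affine_aut elim: pm_one_cases)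
next
  fix d d' assume d: "d \<in> carrier (affine_group j (pm_one j))"
    and d': "d' \<in> carrier (affine_group j (pm_one j))"
  obtain s \<epsilon> where e: "d = (s, \<epsilon> mod (2 * j))" "\<epsilon> = 1 \<or> \<epsilon> = -1"
    using d by (auto simp: affine_carrier elim: pm_one_cases)
  obtain s' \<epsilon>' where e': "d' = (s', \<epsilon>' mod (2 * j))" "\<epsilon>' = 1 \<or> \<epsilon>' = -1" "0 \<le> s'" "s' < 2 * j"
    using d' by (auto simp: affine_carrier elim: pm_one_cases)
  have ee: "\<epsilon> * \<epsilon>' = 1 \<or> \<epsilon> * \<epsilon>' = -1" using e(2) e'(2) by auto
  show "affine_act j p (d \<otimes>\<^bsub>affine_group j (pm_one j)\<^esub> d')
      = affine_act j p d \<otimes>\<^bsub>C_Aut i j p\<^esub> affine_act j p d'"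
    unfolding e(1) e'(1) affine_mult[OF e'(3,4)]
      Aut_mult[OF affine_aut[OF e(2)] affine_aut[OF e'(2)]]
  proof (rule extensional_strand_eqI)
    fix a r assume r: "0 \<le> r" "r \<le> p"
    have "[(s + \<epsilon> * s') mod (2 * j) + \<epsilon> * \<epsilon>' * a = s + \<epsilon> * (s' + \<epsilon>' * a)] (mod 2 * j)"
      by (simp add: cong_def mod_simps algebra_simps)
    then show "affine_act j p ((s + \<epsilon> * s') mod (2 * j), \<epsilon> * \<epsilon>' mod (2 * j)) (strand a r)
      = compose (C_verts j p) (affine_act j p (s, \<epsilon> mod (2 * j)))
         (affine_act j p (s', \<epsilon>' mod (2 * j))) (strand a r)"
      using r by (simp add: compose_eq strand_mem affine_strand ee e(2) e'(2) strand_cong)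
  qed (simp_all add: affine_extensional compose_extensional)
qed

text \<open>The hubs \<open>u\<^sub>0\<close> and \<open>u\<^sub>1\<close> determine \<open>s\<close> and \<open>s + t\<close>.\<close>

lemma affine_same_on_hubs:
  assumes d: "d \<in> carrier (affine_group j (pm_one j))" and d': "d' \<in> carrier (affine_group j (pm_one j))"
    and eq: "\<And>a. affine_act j p d (hub a) = affine_act j p d' (hub a)"
  shows "d = d'"
proof -
  obtain s \<epsilon> where e: "d = (s, \<epsilon> mod (2 * j))" "\<epsilon> = 1 \<or> \<epsilon> = -1" "0 \<le> s" "s < 2 * j"
    using d by (auto simp: affine_carrier elim: pm_one_cases)
  obtain s' \<epsilon>' where e': "d' = (s', \<epsilon>' mod (2 * j))" "\<epsilon>' = 1 \<or> \<epsilon>' = -1" "0 \<le> s'" "s' < 2 * j"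
    using d' by (auto simp: affine_carrier elim: pm_one_cases)
  have cong: "[s + \<epsilon> * a = s' + \<epsilon>' * a] (mod 2 * j)" for a
    using eq[of a] p_pos by (simp add: e(1) e'(1) affine_strand e(2) e'(2) strand_eq_iff)
  have s: "s = s'"
    using cong[of 0] e(3,4) e'(3,4) by (simp add: cong_def)
  have "[\<epsilon> = \<epsilon>'] (mod 2 * j)" using cong[of 1] s by (simp add: cong_add_lcancel)
  then show ?thesis using e(1) e'(1) s by (simp add: cong_def)
qed

lemma aut_affine_on_hubs:
  assumes "f \<in> Auts"
  obtains d where "d \<in> carrier (affine_group j (pm_one j))"
    "\<forall>a. f (hub a) = affine_act j p d (hub a)"
proof -
  obtain b \<epsilon> where "(\<epsilon> = 1 \<or> \<epsilon> = -1) \<and> (\<forall>x. f (hub x) = hub (b + \<epsilon> * x))"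
    using aut_hub_affine[OF assms] by (elim exE)
  then have e: "\<epsilon> = 1 \<or> \<epsilon> = -1" and f: "f (hub x) = hub (b + \<epsilon> * x)" for x
    by simp_all
  show thesis
  proof (rule that)
    show "(b mod (2 * j), \<epsilon> mod (2 * j)) \<in> carrier (affine_group j (pm_one j))"
      using e j_ge_2 by (auto simp: affine_carrier pm_one_eq)
    show "\<forall>a. f (hub a) = affine_act j p (b mod (2 * j), \<epsilon> mod (2 * j)) (hub a)"
    proof
      fix a
      have "hub (b mod (2 * j) + \<epsilon> * a) = hub (b + \<epsilon> * a)"
        by (rule strand_cong) (simp add: cong_def mod_simps)
      then show "f (hub a) = affine_act j p (b mod (2 * j), \<epsilon> mod (2 * j)) (hub a)"
        using e p_pos by (simp add: f affine_strand)
    qed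
  qed
qed

text \<open>A unit \<open>t\<close> of \<open>\<int>\<^sub>2\<^sub>j\<close> is odd, hence \<open>t j = j\<close>, and \<open>t i = \<epsilon> i\<close> for a sign \<open>\<epsilon>\<close> by the condition at
  \<open>i\<close>. Multiplying \<open>1 = k i + m j\<close> by \<open>t\<close> then gives \<open>t = \<epsilon>\<close>, just as for automorphisms on hubs.\<close>

lemma H'_eq: "H' i j = pm_one j"
proof -
  interpret R: residues "2 * j" "residue_ring (2 * j)" by (rule residues_2j) simp
  have mem: "t \<in> H' i j \<longleftrightarrow> 0 < t \<and> t < 2 * j \<and> coprime t (2 * j)
      \<and> {(t * i) mod (2 * j), (t * (- i mod (2 * j))) mod (2 * j)} = {i, - i mod (2 * j)}
      \<and> {(t * j) mod (2 * j), (t * (- j mod (2 * j))) mod (2 * j)} = {j, - j mod (2 * j)}" for t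
    by (simp add: H'_def Let_def R.res_units_eq R.res_neg_eq R.res_mult_eq)
  show ?thesis
  proof (intro equalityI subsetI)
    fix t assume t: "t \<in> H' i j"
    then have bounds: "0 < t" "t < 2 * j" and "coprime t (2 * j)"
      and "(t * i) mod (2 * j) \<in> {i, - i mod (2 * j)}" unfolding mem by auto
    then have "odd t" by auto
    then have tj: "[t * j = j] (mod 2 * j)"
      by (auto elim!: oddE simp: cong_iff_dvd_diff algebra_simps)
    have "i mod (2 * j) = i" using i_pos i_less by simp
    then have "[t * i = 1 * i] (mod 2 * j) \<or> [t * i = - 1 * i] (mod 2 * j)"
      using \<open>(t * i) mod (2 * j) \<in> {i, - i mod (2 * j)}\<close> by (auto simp: cong_def)
    then obtain \<epsilon> where e: "\<epsilon> = 1 \<or> \<epsilon> = -1" and ti: "[t * i = \<epsilon> * i] (mod 2 * j)" by blast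
    obtain k m where one: "[1 = int k * i + m * j] (mod 2 * j)" by (rule residue_decomp)
    have "[t = t * (int k * i + m * j)] (mod 2 * j)"
      using cong_mult[OF cong_refl one, of t] by simp
    also have "t * (int k * i + m * j) = int k * (t * i) + m * (t * j)"
      by (simp add: algebra_simps)
    also have "[\<dots> = int k * (\<epsilon> * i) + m * j] (mod 2 * j)"
      by (rule cong_add[OF cong_mult[OF cong_refl ti] cong_mult[OF cong_refl tj]])
    also have "[int k * (\<epsilon> * i) + m * j = int k * (\<epsilon> * i) + \<epsilon> * (m * j)] (mod 2 * j)"
      using mult_pm_j[OF e] by (intro cong_add) auto
    also have "int k * (\<epsilon> * i) + \<epsilon> * (m * j) = \<epsilon> * (int k * i + m * j)"
      by (simp add: algebra_simps)
    also have "[\<dots> = \<epsilon> * 1] (mod 2 * j)"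
      using cong_sym[OF one] by (intro cong_mult) auto
    finally show "t \<in> pm_one j"
      using e bounds by (auto simp: pm_one_eq cong_def)
  next
    fix t assume "t \<in> pm_one j"
    then obtain \<epsilon> where e: "\<epsilon> = 1 \<or> \<epsilon> = -1" and t: "t = \<epsilon> mod (2 * j)" by (rule pm_one_cases)
    have m1: "(-1) mod (2 * j) = 2 * j - 1" using j_ge_2 by (intro int_mod_pos_eq[of _ _ "-1"]) auto
    have "coprime (2 * j - 1) (2 * j)" by (rule coprime_diff_one_left)
    then have "0 < t" "t < 2 * j" "coprime t (2 * j)"
      using e t m1 j_ge_2 by auto
    moreover have "(t * x) mod (2 * j) = (\<epsilon> * x) mod (2 * j)"
      "(t * (- x mod (2 * j))) mod (2 * j) = (\<epsilon> * - x) mod (2 * j)" for x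
      unfolding t by (simp_all only: mod_mult_left_eq mod_mult_right_eq)
    moreover have "i mod (2 * j) = i" "j mod (2 * j) = j" using i_pos i_less by simp_all
    ultimately show "t \<in> H' i j"
      unfolding mem using e by (elim disjE) (simp_all add: insert_commute)
  qed
qed


section \<open>The kernel of the action on the hubs\<close>

text \<open>The product of the \<open>\<beta>\<^sub>a\<close> over \<open>a \<in> S\<close>, for a set \<open>S\<close> of residues modulo \<open>j\<close>. Indexing by residues
  modulo \<open>j\<close> reflects that the strands of index \<open>a\<close> and \<open>a + j\<close> are swapped together.\<close>

definition flip :: "int set \<Rightarrow> vertex \<Rightarrow> vertex" where
  "flip S = (\<lambda>x\<in>C_verts j p. (case x of
       Uvert b \<Rightarrow> Uvert b
     | Vvert b r \<Rightarrow>
         if b mod j \<in> S then Vvert ((b + j) mod (2 * j)) (p + 1 - r) else Vvert b r))"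

lemma flip_strand:
  assumes r: "0 \<le> r" "r \<le> p + 1"
  shows "flip S (strand a r) = (if a mod j \<in> S then strand (a + j) (p + 1 - r) else strand a r)"
proof -
  have pos: "0 \<le> b mod (2 * j)" "b mod (2 * j) < 2 * j" for b using j_ge_2 by simp_all
  have 2: "(a + j + j) mod (2 * j) = a mod (2 * j)" by (simp add: mod_add_self2 add.assoc)
  have mm: "a mod (2 * j) mod j = a mod j" by (simp add: mod_mod_cancel)
  consider "r = 0" | "1 \<le> r" "r \<le> p" | "r = p + 1" using r by linarith
  then show ?thesis
    using p_pos pos 2 mm by cases (auto simp: flip_def strand_def C_verts_def mod_simps)
qed

lemma flip_extensional: "flip S \<in> extensional (C_verts j p)"
  by (simp add: flip_def)

lemma flip_hub: "flip S (hub a) = hub a"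
  using p_pos by (simp add: flip_strand strand_last strand_2j)

lemma flip_mem: "x \<in> C_verts j p \<Longrightarrow> flip S x \<in> C_verts j p"
  by (erule vertex_cases) (simp add: flip_strand strand_mem)

text \<open>Swapping twice restores a strand, so composition is symmetric difference.\<close>

lemma flip_flip:
  assumes "x \<in> C_verts j p"
  shows "flip S (flip T x) = flip ((S - T) \<union> (T - S)) x"
  by (rule vertex_cases[OF assms]) (auto simp: flip_strand strand_2j)

lemma flip_aut: "flip S \<in> Auts"
proof (rule automorphism_if_inverse_pair[where g = "flip S"])
  have "flip S (flip S x) = x" if x: "x \<in> C_verts j p" for x
    using x by (rule vertex_cases) (simp add: flip_flip[OF x] flip_strand strand_2j)
  then show "flip S (flip S x) = x" "flip S (flip S x) = x" if "x \<in> C_verts j p" for x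
    using that by simp_all
  have edge: "{flip S x, flip S y} \<in> C_edges i j p" if "{x, y} \<in> C_edges i j p" for x y
  proof (rule edge_preserving[OF _ _ that])
    fix a r assume "0 \<le> r" "r \<le> p"
    then show "{flip S (strand a r), flip S (strand a (r + 1))} \<in> C_edges i j p"
      using strand_edge[of r a] strand_edge[of "p - r" "a + j"]
      by (simp add: flip_strand insert_commute algebra_simps)
  qed (simp add: flip_hub hub_edge)
  then show "{flip S x, flip S y} \<in> C_edges i j p" "{flip S x, flip S y} \<in> C_edges i j p"
    if "{x, y} \<in> C_edges i j p" for x y
    using that by simp_all
qed (simp_all add: flip_extensional flip_mem)

lemma flip_mult: "flip S \<otimes>\<^bsub>C_Aut i j p\<^esub> flip T = flip ((S - T) \<union> (T - S))"
  unfolding Aut_mult[OF flip_aut flip_aut]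
  by (rule extensionalityI[of _ "C_verts j p"]) (simp_all add: flip_extensional compose_eq flip_flip)

lemma flip_empty: "flip {} = \<one>\<^bsub>C_Aut i j p\<^esub>"
  unfolding Aut_one
  by (rule extensional_strand_eqI) (simp_all add: flip_extensional flip_strand strand_mem)

lemma strand_ne_opposite: "strand a 1 \<noteq> strand (a + j) p"
  using p_pos shift_neq(1)[of a] by (auto simp: strand_eq_iff dest: cong_sym)

lemma flip_inj: "inj_on flip (Pow {0..<j})"
proof (rule inj_onI)
  fix S T assume S: "S \<in> Pow {0..<j}" and T: "T \<in> Pow {0..<j}" and eq: "flip S = flip T"
  have "a \<in> S \<longleftrightarrow> a \<in> T" if "a \<in> {0..<j}" for a
    using fun_cong[OF eq, of "strand a 1"] that strand_ne_opposite[of a] p_pos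
    by (auto simp: flip_strand split: if_splits)
  then show "S = T" using S T by blast
qed

text \<open>With its ends fixed, a strand is either fixed pointwise or sent to the opposite strand with
  the same ends. Which of the two happens is the same for the indices \<open>a\<close> and \<open>a + j\<close>, by
  injectivity, so the swapped strands are described by a set of residues modulo \<open>j\<close>.\<close>

lemma aut_fixing_hubs:
  assumes f: "f \<in> Auts" and hub: "\<And>a. f (hub a) = hub a"
  obtains S where "S \<subseteq> {0..<j}" "f = flip S"
proof
  let ?fix = "\<lambda>a. f (strand a 1) = strand a 1"
  let ?S = "{a \<in> {0..<j}. \<not> ?fix a}"
  show "?S \<subseteq> {0..<j}" by blast
  have fixed: "f (strand a r) = strand a r" if "?fix a" "0 \<le> r" "r \<le> p" for a r
    using aut_strand[OF f hub[of a]] that strand_ne_opposite[of a] p_pos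
    by (auto dest: bspec[of _ _ 1])
  have swapped: "f (strand a r) = strand (a + j) (p + 1 - r)" if "\<not> ?fix a" "0 \<le> r" "r \<le> p" for a r
    using aut_strand[OF f hub[of a]] that p_pos by (auto dest: bspec[of _ _ 1])
  have opp: "?fix (a + j)" if "?fix a" for a
  proof (rule ccontr)
    (* otherwise the opposite strand is sent onto strand a, which is its own image *)
    assume "\<not> ?fix (a + j)"
    then have "f (strand (a + j) 1) = strand a p"
      using swapped[of "a + j" 1] p_pos by (simp add: strand_2j)
    also have "\<dots> = f (strand a p)" using fixed[OF that, of p] p_pos by simp
    finally have "strand (a + j) 1 = strand a p"
      using aut_inj[OF f strand_mem strand_mem, of 1 p] p_pos by simp
    then show False using strand_ne_opposite[of "a + j"] by (simp add: strand_2j)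
  qed
  have opp_iff: "?fix (a + j) \<longleftrightarrow> ?fix a" for a
    using opp[of a] opp[of "a + j"] by (auto simp: strand_2j)
  have reduce: "?fix a \<longleftrightarrow> ?fix (a mod j)" for a
  proof -
    have a: "a - a mod j = a div j * j" by (simp add: minus_mod_eq_div_mult)
    show ?thesis
    proof (cases "even (a div j)")
      case True
      then have "[a = a mod j] (mod 2 * j)"
        unfolding cong_iff_dvd_diff a by (rule mult_dvd_mono) simp
      then show ?thesis by (simp add: strand_cong[of a "a mod j"])
    next
      case False
      have "a - (a mod j + j) = (a div j - 1) * j" using a by (simp add: algebra_simps)
      moreover have "even (a div j - 1)" using False by simp
      ultimately have "[a = a mod j + j] (mod 2 * j)"
        unfolding cong_iff_dvd_diff by (simp add: mult_dvd_mono)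
      then show ?thesis using opp_iff[of "a mod j"] by (simp add: strand_cong[of a "a mod j + j"])
    qed
  qed
  show "f = flip ?S"
  proof (rule extensional_strand_eqI)
    fix a r assume r: "0 \<le> r" "r \<le> p"
    have "a mod j \<in> ?S \<longleftrightarrow> \<not> ?fix a" using reduce[of a] j_ge_2 by auto
    then show "f (strand a r) = flip ?S (strand a r)"
      using fixed[of a r] swapped[of a r] r by (simp add: flip_strand)
  qed (use f in \<open>simp_all add: aut_extensional flip_extensional\<close>)
qed

lemma beta_eq_flip:
  assumes a: "a \<in> {0..<j}"
  shows "beta j p a = flip {a}"
proof -
  have "b \<in> {a, (a + j) mod (2 * j)} \<longleftrightarrow> b mod j \<in> {a}" if "0 \<le> b" "b < 2 * j" for b
  proof (cases "b < j")
    case True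
    then show ?thesis using a that by simp
  next
    case False
    then have "b mod j = b - j" using that by (intro int_mod_pos_eq[of _ _ 1]) auto
    then show ?thesis using a that False by auto
  qed
  then show ?thesis
    unfolding beta_def flip_def by (intro restrict_ext) (auto simp: C_verts_def split: vertex.split)
qed

lemma flip_in_B: "S \<subseteq> {0..<j} \<Longrightarrow> flip S \<in> B_set i j p"
proof -
  assume S: "S \<subseteq> {0..<j}"
  then have "finite S" by (rule finite_subset) simp
  then show ?thesis using S
  proof (induction S rule: finite_induct)
    case empty
    then show ?case by (simp add: flip_empty B_set_def generate.one)
  next
    case (insert a S)
    then have "flip {a} \<in> B_set i j p"
      unfolding B_set_def by (intro generate.incl) (auto simp: beta_eq_flip[symmetric])
    moreover have "flip S \<in> B_set i j p" using insert by simp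
    ultimately have "flip {a} \<otimes>\<^bsub>C_Aut i j p\<^esub> flip S \<in> B_set i j p"
      unfolding B_set_def by (rule generate.eng)
    moreover have "({a} - S) \<union> (S - {a}) = insert a S" using insert by blast
    ultimately show ?case by (simp add: flip_mult)
  qed
qed

lemma B_subset_flips: "B_set i j p \<subseteq> flip ` Pow {0..<j}"
proof
  fix f assume "f \<in> B_set i j p"
  then show "f \<in> flip ` Pow {0..<j}"
    unfolding B_set_def
  proof (induction rule: generate.induct)
    case one
    then show ?case by (auto simp: flip_empty[symmetric])
  next
    case (incl h)
    then show ?case by (auto simp: beta_eq_flip)
  next
    case (inv h)
    then obtain a where a: "a \<in> {0..<j}" "h = flip {a}" by (auto simp: beta_eq_flip)
    have "inv\<^bsub>C_Aut i j p\<^esub> flip {a} = flip {a}"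
      by (rule Aut.inv_equality) (simp_all add: flip_mult flip_empty C_Aut_carrier flip_aut)
    then show ?case using a by auto
  next
    case (eng h1 h2)
    then obtain S T where "S \<subseteq> {0..<j}" "T \<subseteq> {0..<j}" "h1 = flip S" "h2 = flip T" by auto
    then show ?case by (auto simp: flip_mult)
  qed
qed

lemma B_set_eq_kernel: "B_set i j p = {f \<in> Auts. \<forall>a. f (hub a) = hub a}"
proof
  show "B_set i j p \<subseteq> {f \<in> Auts. \<forall>a. f (hub a) = hub a}"
    using B_subset_flips flip_aut flip_hub by blast
  show "{f \<in> Auts. \<forall>a. f (hub a) = hub a} \<subseteq> B_set i j p"
    using aut_fixing_hubs flip_in_B by blast
qed

lemma B_normal: "B_set i j p \<lhd> C_Aut i j p"
proof (rule Aut.normal_invI)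
  show "subgroup (B_set i j p) (C_Aut i j p)"
    unfolding B_set_def
    by (rule Aut.generate_is_subgroup) (auto simp: beta_eq_flip C_Aut_carrier flip_aut)
  fix g f assume "g \<in> carrier (C_Aut i j p)" and f: "f \<in> B_set i j p"
  then have g: "g \<in> Auts" and fA: "f \<in> Auts" and fh: "\<And>a. f (hub a) = hub a"
    by (auto simp: C_Aut_carrier B_set_eq_kernel)
  have gf: "g \<otimes>\<^bsub>C_Aut i j p\<^esub> f \<in> Auts"
    using Aut.m_closed[of g f] g fA by (simp add: C_Aut_carrier)
  have "\<forall>a. (g \<otimes>\<^bsub>C_Aut i j p\<^esub> f) (hub a) = g (hub a)"
    using g fA fh by (simp add: Aut_mult_apply)
  then show "g \<otimes>\<^bsub>C_Aut i j p\<^esub> f \<otimes>\<^bsub>C_Aut i j p\<^esub> inv\<^bsub>C_Aut i j p\<^esub> g \<in> B_set i j p"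
    using same_on_hubs_iff[OF gf g] gf g
      Aut.m_closed[of "g \<otimes>\<^bsub>C_Aut i j p\<^esub> f" "inv\<^bsub>C_Aut i j p\<^esub> g"] Aut.inv_closed[of g]
    by (simp add: B_set_eq_kernel C_Aut_carrier)
qed

text \<open>The coset of \<open>g\<close> modulo \<open>B\<close> is its action on the hubs, which is affine; so exactly one element
  of \<open>\<int>\<^sub>2\<^sub>j \<rtimes> {\<plusminus>1}\<close> acts on the hubs as \<open>g\<close> does.\<close>

lemma affine_transversal:
  "\<forall>g\<in>carrier (C_Aut i j p). \<exists>!d\<in>carrier (affine_group j (pm_one j)).
    g \<otimes>\<^bsub>C_Aut i j p\<^esub> inv\<^bsub>C_Aut i j p\<^esub> (affine_act j p d) \<in> B_set i j p"
proof
  fix g assume "g \<in> carrier (C_Aut i j p)"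
  then have g: "g \<in> Auts" by (simp add: C_Aut_carrier)
  have iff: "g \<otimes>\<^bsub>C_Aut i j p\<^esub> inv\<^bsub>C_Aut i j p\<^esub> (affine_act j p d) \<in> B_set i j p
      \<longleftrightarrow> (\<forall>a. g (hub a) = affine_act j p d (hub a))"
    if "d \<in> carrier (affine_group j (pm_one j))" for d
  proof -
    have d: "affine_act j p d \<in> Auts"
      using hom_in_carrier[OF affine_hom that] by (simp add: C_Aut_carrier)
    then have "g \<otimes>\<^bsub>C_Aut i j p\<^esub> inv\<^bsub>C_Aut i j p\<^esub> (affine_act j p d) \<in> Auts"
      using g Aut.m_closed[of g "inv\<^bsub>C_Aut i j p\<^esub> (affine_act j p d)"] Aut.inv_closed[of "affine_act j p d"]
      by (simp add: C_Aut_carrier)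
    then show ?thesis using same_on_hubs_iff[OF g d] by (simp add: B_set_eq_kernel)
  qed
  obtain d where d: "d \<in> carrier (affine_group j (pm_one j))"
    "\<forall>a. g (hub a) = affine_act j p d (hub a)"
    using aut_affine_on_hubs[OF g] .
  show "\<exists>!d\<in>carrier (affine_group j (pm_one j)).
    g \<otimes>\<^bsub>C_Aut i j p\<^esub> inv\<^bsub>C_Aut i j p\<^esub> (affine_act j p d) \<in> B_set i j p"
  proof (rule ex1I[of _ d])
    show "d \<in> carrier (affine_group j (pm_one j))
      \<and> g \<otimes>\<^bsub>C_Aut i j p\<^esub> inv\<^bsub>C_Aut i j p\<^esub> (affine_act j p d) \<in> B_set i j p"
      using d iff by simp
    fix d' assume "d' \<in> carrier (affine_group j (pm_one j))
      \<and> g \<otimes>\<^bsub>C_Aut i j p\<^esub> inv\<^bsub>C_Aut i j p\<^esub> (affine_act j p d') \<in> B_set i j p"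
    then show "d' = d" using d iff[of d'] by (intro affine_same_on_hubs) auto
  qed
qed

section \<open>Coordinates for the kernel\<close>

definition flip_vector :: "(int \<Rightarrow> int) \<Rightarrow> vertex \<Rightarrow> vertex" where
  "flip_vector x = flip {a \<in> {0..<j}. x a = 1}"

lemma Z2_power_carrier: "carrier (Z2_power j) = {0..<j} \<rightarrow>\<^sub>E {0, 1}"
proof -
  have "{0..1} = {0, 1::int}" by auto
  then show ?thesis by (simp add: Z2_power_def residue_ring_def)
qed

lemma Z2_power_group: "group (Z2_power j)"
proof -
  interpret R: residues 2 "residue_ring 2" by unfold_locales simp_all
  show ?thesis unfolding Z2_power_def using R.a_group by (intro product_group)
qed

lemma flip_vector_iso: "flip_vector \<in> iso (Z2_power j) (B_group i j p)"
proof (rule isoI)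
  show "flip_vector \<in> hom (Z2_power j) (B_group i j p)"
  proof (rule homI)
    fix x y assume x: "x \<in> carrier (Z2_power j)" and y: "y \<in> carrier (Z2_power j)"
    show "flip_vector x \<in> carrier (B_group i j p)"
      by (auto simp: flip_vector_def B_group_def intro: flip_in_B)
    have "(x \<otimes>\<^bsub>Z2_power j\<^esub> y) a = 1 \<longleftrightarrow> (x a = 1) \<noteq> (y a = 1)" if a: "a \<in> {0..<j}" for a
    proof -
      have "x a \<in> {0, 1}" "y a \<in> {0, 1}" using x y a by (auto simp: Z2_power_carrier)
      then show ?thesis using a by (auto simp: Z2_power_def residue_ring_def)
    qed
    then show "flip_vector (x \<otimes>\<^bsub>Z2_power j\<^esub> y) = flip_vector x \<otimes>\<^bsub>B_group i j p\<^esub> flip_vector y"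
      by (auto simp: flip_vector_def B_group_def flip_mult intro!: arg_cong[of _ _ flip])
  qed
  show "bij_betw flip_vector (carrier (Z2_power j)) (carrier (B_group i j p))"
  proof (intro bij_betw_imageI inj_onI equalityI subsetI)
    fix x y assume x: "x \<in> carrier (Z2_power j)" and y: "y \<in> carrier (Z2_power j)"
      and eq: "flip_vector x = flip_vector y"
    have S: "{a \<in> {0..<j}. x a = 1} = {a \<in> {0..<j}. y a = 1}"
      using eq by (intro inj_onD[OF flip_inj]) (auto simp: flip_vector_def)
    show "x = y"
    proof (rule PiE_ext)
      fix a assume a: "a \<in> {0..<j}"
      then have "x a \<in> {0, 1}" "y a \<in> {0, 1}" using x y by (auto simp: Z2_power_carrier)
      moreover have "x a = 1 \<longleftrightarrow> y a = 1" using S a by blast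
      ultimately show "x a = y a" by auto
    qed (use x y in \<open>simp_all add: Z2_power_carrier\<close>)
  next
    fix f assume "f \<in> flip_vector ` carrier (Z2_power j)"
    then show "f \<in> carrier (B_group i j p)"
      by (auto simp: flip_vector_def B_group_def intro: flip_in_B)
  next
    fix f assume "f \<in> carrier (B_group i j p)"
    then obtain S where S: "S \<subseteq> {0..<j}" "f = flip S"
      using B_subset_flips by (auto simp: B_group_def)
    let ?x = "\<lambda>a\<in>{0..<j}. if a \<in> S then 1 else (0::int)"
    have "{a \<in> {0..<j}. ?x a = 1} = S" using S(1) by auto
    then have "f = flip_vector ?x" using S by (simp add: flip_vector_def)
    moreover have "?x \<in> carrier (Z2_power j)" by (auto simp: Z2_power_carrier)
    ultimately show "f \<in> flip_vector ` carrier (Z2_power j)" by (rule image_eqI)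
  qed
qed

lemma flip_vector_unit: "a \<in> {0..<j} \<Longrightarrow> flip_vector (Z2_unit j a) = beta j p a"
proof -
  assume a: "a \<in> {0..<j}"
  then have "{b \<in> {0..<j}. Z2_unit j a b = 1} = {a}" by (auto simp: Z2_unit_def)
  then show ?thesis using a by (simp add: flip_vector_def beta_eq_flip)
qed

end

section \<open>The semidirect decomposition\<close>

theorem theorem27:
  fixes i j p :: int
  assumes "0 < i" and "i < j"
    and "gcd (gcd (2 * j) i) j = 1"
    and "1 \<le> p"
    and "i = 1 \<or> (i \<notin> Units (residue_ring (2 * j)) \<and> j \<notin> Units (residue_ring (2 * j)))"
  shows "H' i j = pm_one j
    \<and> affine_act j p \<in> mon (affine_group j (H' i j)) (C_Aut i j p)
    \<and> B_set i j p \<lhd> C_Aut i j p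
    \<and> B_conj i j p \<in> hom (affine_group j (H' i j)) (AutoGroup (B_group i j p))
    \<and> (\<lambda>(b, d). b \<otimes>\<^bsub>C_Aut i j p\<^esub> affine_act j p d)
           \<in> iso (semidirect (B_group i j p) (affine_group j (H' i j)) (B_conj i j p))
                 (C_Aut i j p)
    \<and> (\<exists>\<psi> \<theta>. \<psi> \<in> iso (Z2_power j) (B_group i j p)
           \<and> (\<forall>a\<in>{0..<j}. \<psi> (Z2_unit j a) = beta j p a)
           \<and> \<theta> \<in> hom (affine_group j (pm_one j)) (AutoGroup (Z2_power j))
           \<and> (\<lambda>(x, d). \<psi> x \<otimes>\<^bsub>C_Aut i j p\<^esub> affine_act j p d)
                \<in> iso (semidirect (Z2_power j) (affine_group j (pm_one j)) \<theta>) (C_Aut i j p))"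
proof -
  have "gcd (gcd (2 * j) i) j = gcd i j"
    by (simp add: gcd.commute[of "2 * j" i] gcd.assoc)
  then have "coprime i j" using assms(3) by (simp add: coprime_iff_gcd_eq_1)
  then interpret C_graph i j p
    using assms by unfold_locales
  note decomposition = Aut.internal_semidirect[OF B_normal affine_hom affine_transversal,
      folded B_group_def]
  have conj: "(\<lambda>d. \<lambda>b\<in>B_set i j p. affine_act j p d \<otimes>\<^bsub>C_Aut i j p\<^esub> b
      \<otimes>\<^bsub>C_Aut i j p\<^esub> inv\<^bsub>C_Aut i j p\<^esub> (affine_act j p d)) = B_conj i j p"
    by (rule ext) (simp add: B_conj_def)
  note decomposition = decomposition[unfolded conj]
  obtain \<theta> where "\<theta> \<in> hom (affine_group j (pm_one j)) (AutoGroup (Z2_power j))"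
    "(\<lambda>(x, d). flip_vector x \<otimes>\<^bsub>C_Aut i j p\<^esub> affine_act j p d)
       \<in> iso (semidirect (Z2_power j) (affine_group j (pm_one j)) \<theta>) (C_Aut i j p)"
    using semidirect_transport[OF Z2_power_group flip_vector_iso decomposition(2,3)] .
  then show ?thesis
    unfolding H'_eq
    by (intro conjI exI[of _ flip_vector] exI[of _ \<theta>] ballI refl B_normal decomposition
        flip_vector_iso flip_vector_unit)
qed

end
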